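(* Let $\mu\ge1$ be an integer, $g\in C^\infty[-1,1]$, and $\lambda>-\frac12$, $\lambda\ne0$. Write $\mathcal N_0$ for the set of integers. The Gegenbauer coefficients $a_n(\lambda)$ and Chebyshev coefficients $c_n$ of $f$ satisfy, as $n\to\infty$: (1) For $f(x)=(1-x)^{\gamma}\ln^{\mu}(1-x)g(x)$, $\gamma\in\mathbb R$: $$|a_n(\lambda)|=\begin{cases}O(\ln^{\mu}(n)\,n^{-2\lambda-2\gamma}),&\lambda+\gamma>-\frac12,\ \gamma\notin\mathcal N_0,\\ O(\ln^{\mu-1}(n)\,n^{-2\lambda-2\gamma}),&\lambda+\gamma>-\frac12,\ \gamma\in\mathcal N_0,\end{cases}$$ $$|c_n|=\begin{cases}O(\ln^{\mu}(n)\,n^{-1-2\gamma}),&\gamma>-\frac12,\ \gamma\notin\mathcal N_0,\\ O(\ln^{\mu-1}(n)\,n^{-1-2\gamma}),&\gamma>-\frac12,\ \gamma\in\mathcal N_0.\end{cases}$$ (2) For $f(x)=(1+x)^{\delta}\ln^{\mu}(1+x)g(x)$, $\delta\in\mathbb R$: $$|a_n(\lambda)|=\begin{cases}O(\ln^{\mu}(n)\,n^{-2\lambda-2\delta}),&\lambda+\delta>-\frac12,\ \delta\notin\mathcal N_0,\\ O(\ln^{\mu-1}(n)\,n^{-2\lambda-2\delta}),&\lambda+\delta>-\frac12,\ \delta\in\mathcal N_0,\end{cases}$$ $$|c_n|=\begin{cases}O(\ln^{\mu}(n)\,n^{-1-2\delta}),&\delta>-\frac12,\ \delta\notin\mathcal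 N_0,\\ O(\ln^{\mu-1}(n)\,n^{-1-2\delta}),&\delta>-\frac12,\ \delta\in\mathcal N_0.\end{cases}$$
   Context: $C_n^{(\lambda)}$ is the Gegenbauer polynomial of degree $n$ and $T_n$ the Chebyshev polynomial of the first kind. $a_n(\lambda)=\frac1{h_n}\int_{-1}^1(1-x^2)^{\lambda-1/2}C_n^{(\lambda)}(x)f(x)\,dx$ with $h_n=\int_{-1}^1(1-x^2)^{\lambda-1/2}[C_n^{(\lambda)}(x)]^2dx=\frac{2^{1-2\lambda}\pi}{\Gamma(\lambda)^2}\frac{\Gamma(n+2\lambda)}{n!(n+\lambda)}$. The Chebyshev coefficients are those of $f=\sum_{n\ge0}c_nT_n$, i.e. $c_n=\frac2\pi\int_{-1}^1\frac{f(x)T_n(x)}{\sqrt{1-x^2}}dx$ for $n\ge1$. Constants in the $O$-terms may depend on everything except $n$.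
   Formalization: 𝒩₀ is taken to be the nonnegative integers, not all integers: for negative integer γ (or δ) the bound on a_n(λ) has ln^μ(n), since ln^{μ-1}(n) fails, e.g. λ=1, γ=-1, μ=1, g=1 gives a_n = -2ln2 - 4H_n - 2/(n+1). *)

theory Defs
  imports "HOL-Analysis.Analysis" "HOL-Computational_Algebra.Polynomial" "HOL-Library.Landau_Symbols"
begin

fun gegenbauer_poly :: "real \<Rightarrow> nat \<Rightarrow> real poly" where
  "gegenbauer_poly l 0 = 1"
| "gegenbauer_poly l (Suc 0) = [:0, 2 * l:]"
| "gegenbauer_poly l (Suc (Suc n)) =
     smult (1 / real (n + 2))
       ([:0, 2 * (real n + 1 + l):] * gegenbauer_poly l (Suc n)
        - smult (real n + 2 * l) (gegenbauer_poly l n))"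

fun chebyshev_poly :: "nat \<Rightarrow> real poly" where
  "chebyshev_poly 0 = 1"
| "chebyshev_poly (Suc 0) = [:0, 1:]"
| "chebyshev_poly (Suc (Suc n)) = [:0, 2:] * chebyshev_poly (Suc n) - chebyshev_poly n"

definition gegenbauer_norm :: "real \<Rightarrow> nat \<Rightarrow> real" where
  "gegenbauer_norm l n =
     (LBINT x:{-1..1}. (1 - x\<^sup>2) powr (l - 1/2) * (poly (gegenbauer_poly l n) x)\<^sup>2)"

definition gegenbauer_coeff :: "real \<Rightarrow> (real \<Rightarrow> real) \<Rightarrow> nat \<Rightarrow> real" where
  "gegenbauer_coeff l f n =
     (LBINT x:{-1..1}. (1 - x\<^sup>2) powr (l - 1/2) * poly (gegenbauer_poly l n) x * f x)
       / gegenbauer_norm l n"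

definition chebyshev_coeff :: "(real \<Rightarrow> real) \<Rightarrow> nat \<Rightarrow> real" where
  "chebyshev_coeff f n =
     (if n = 0 then 1 else 2) / pi * (LBINT x:{-1..1}. f x * poly (chebyshev_poly n) x / sqrt (1 - x\<^sup>2))"

(* One-sided derivatives at the endpoints when S is a closed interval; G k is the k-th derivative. *)
definition smooth_on_interval :: "real set \<Rightarrow> (real \<Rightarrow> real) \<Rightarrow> bool" where
  "smooth_on_interval S g \<longleftrightarrow>
     (\<exists>G :: nat \<Rightarrow> real \<Rightarrow> real. G 0 = g \<and>
        (\<forall>k. \<forall>x\<in>S. (G k has_real_derivative G (Suc k) x) (at x within S)))"

end

theory Submission
  imports Defs
begin

text \<open>
  Write \<open>P\<^sub>n\<close> for the Gegenbauer polynomial normalised by \<open>P\<^sub>n 1 = 1\<close>, \<open>w = (1 - x\<^sup>2) powr (l - 1/2)\<close> and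
  \<open>y = 1 - x\<close>. Both coefficients are explicit multiples of \<open>\<integral> w P\<^sub>n f\<close>, so it suffices to bound that
  integral by \<open>n powr (- 2 * c - 2 * l - 1)\<close> times the right power of \<open>ln n\<close>.

  Taylor expansion of \<open>g\<close> at \<open>1\<close> reduces \<open>f\<close> to finitely many terms \<open>y\<^sup>c\<^sup>+\<^sup>k ln\<^sup>M y\<close> plus a remainder that is as
  flat at \<open>1\<close> as desired. The remainder is negligible, since the Gegenbauer differential operator is
  self-adjoint with eigenvalue \<open>n (n + 2 l)\<close> at \<open>P\<^sub>n\<close> and can be moved onto it any number of times.

  For the moments \<open>J n m = \<integral> w P\<^sub>n y\<^sup>c ln\<^sup>m y\<close> one integration by parts gives the recurrence
  \<open>(n + c + 2 l + 1) J (n + 1) m = (n - c) J n m - m (J n (m - 1) + J (n + 1) (m - 1))\<close>, so the weighted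
  sum of \<open>\<bar>J n m\<bar> r\<^sup>m / m!\<close> over \<open>m\<close> grows at most by the factor \<open>(\<bar>n - c\<bar> + r) / (n + c + 2 l + 1 - r)\<close>.
  The choice \<open>r = r\<^sub>0 / ln n\<close> yields \<open>J n M = O(ln\<^sup>M n * n powr (- 2 * c - 2 * l - 1))\<close>. If \<open>c\<close> is a natural number,
  the factor with index \<open>c\<close> is \<open>O(1 / ln n)\<close>, which saves one logarithm.
\<close>

subsection \<open>Normalised Gegenbauer polynomials\<close>

text \<open>In this normalisation \<open>l = 0\<close> is not degenerate and gives the Chebyshev polynomials.\<close>
fun gegen :: "real \<Rightarrow> nat \<Rightarrow> real poly" where
  "gegen l 0 = 1"
| "gegen l (Suc 0) = [:0, 1:]"
| "gegen l (Suc (Suc n)) =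
     smult (1 / (real n + 1 + 2 * l))
       ([:0, 2 * (real n + 1 + l):] * gegen l (Suc n) - smult (real n + 1) (gegen l n))"

lemma gegen_rec:
  assumes "l > -1/2"
  shows "(real n + 1 + 2 * l) * poly (gegen l (Suc (Suc n))) x =
    2 * (real n + 1 + l) * x * poly (gegen l (Suc n)) x - (real n + 1) * poly (gegen l n) x"
proof -
  have "real n + 1 + 2 * l \<noteq> 0" using assms by linarith
  moreover have "poly (gegen l (Suc (Suc n))) x = (2 * (real n + 1 + l) * x * poly (gegen l (Suc n)) x
      - (real n + 1) * poly (gegen l n) x) / (real n + 1 + 2 * l)"
    by (simp add: mult.commute)
  ultimately show ?thesis by (simp del: gegen.simps)
qed

lemma pderiv_gegen_rec:
  assumes "l > -1/2"
  shows "(real n + 1 + 2 * l) * poly (pderiv (gegen l (Suc (Suc n)))) x =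
    2 * (real n + 1 + l) * (poly (gegen l (Suc n)) x + x * poly (pderiv (gegen l (Suc n))) x)
      - (real n + 1) * poly (pderiv (gegen l n)) x"
proof -
  have nz: "real n + 1 + 2 * l \<noteq> 0" using assms by linarith
  have "poly (pderiv (gegen l (Suc (Suc n)))) x =
     (2 * (real n + 1 + l) * (poly (gegen l (Suc n)) x + x * poly (pderiv (gegen l (Suc n))) x)
      - (real n + 1) * poly (pderiv (gegen l n)) x) / (real n + 1 + 2 * l)"
    by (simp add: pderiv_smult pderiv_diff pderiv_mult pderiv_pCons)
       (intro disjI2, algebra)
  with nz show ?thesis by (simp del: gegen.simps)
qed

lemma gegen_minus: "poly (gegen l n) (- x) = (-1) ^ n * poly (gegen l n) x"
  by (induction l n rule: gegen.induct) (simp_all add: algebra_simps)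

lemma gegen_at_1:
  assumes "l > -1/2"
  shows "poly (gegen l n) 1 = 1"
  using assms
proof (induction l n rule: gegen.induct)
  case (3 l n)
  then have "(real n + 1 + 2 * l) * poly (gegen l (Suc (Suc n))) 1 = (real n + 1 + 2 * l) * 1"
    by (subst gegen_rec) (simp_all add: algebra_simps)
  moreover have "real n + 1 + 2 * l \<noteq> 0" using 3 by linarith
  ultimately show ?case by (metis mult_left_cancel)
qed simp_all

lemma gegen_at_minus_1:
  assumes "l > -1/2"
  shows "poly (gegen l n) (-1) = (-1) ^ n"
  using gegen_minus[of l n 1] gegen_at_1[OF assms] by simp

text \<open>The two ladder relations need each other, hence the joint induction. The lowering
  relation at \<open>Suc n\<close>, rewritten by the three-term recurrence, is the raising relation
  at \<open>Suc n\<close>; the differentiated recurrence then yields the next lowering relation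
  after cancelling \<open>n + 1 + 2 * l\<close>.\<close>

lemma pderiv_gegen_aux:
  assumes "l > -1/2"
  shows "(1 - x\<^sup>2) * poly (pderiv (gegen l n)) x
            = (real n + 2 * l) * (x * poly (gegen l n) x - poly (gegen l (Suc n)) x)
       \<and> (1 - x\<^sup>2) * poly (pderiv (gegen l (Suc n))) x
            = (real n + 1) * (poly (gegen l n) x - x * poly (gegen l (Suc n)) x)"
proof (induction n)
  case 0
  show ?case by (simp add: pderiv_pCons algebra_simps power2_eq_square)
next
  case (Suc n)
  define p0 p1 p2 where "p0 = poly (gegen l n) x" and "p1 = poly (gegen l (Suc n)) x"
    and "p2 = poly (gegen l (Suc (Suc n))) x"
  define d0 d1 d2 where "d0 = poly (pderiv (gegen l n)) x" and "d1 = poly (pderiv (gegen l (Suc n))) x"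
    and "d2 = poly (pderiv (gegen l (Suc (Suc n)))) x"
  define N where "N = real n"
  have nz: "N + 1 + 2 * l \<noteq> 0" using assms by (simp add: N_def)
  have r: "(N + 1 + 2 * l) * p2 = 2 * (N + 1 + l) * x * p1 - (N + 1) * p0"
    unfolding N_def p0_def p1_def p2_def by (rule gegen_rec[OF assms])
  have rd: "(N + 1 + 2 * l) * d2 = 2 * (N + 1 + l) * (p1 + x * d1) - (N + 1) * d0"
    unfolding N_def p0_def p1_def p2_def d0_def d1_def d2_def by (rule pderiv_gegen_rec[OF assms])
  have i0: "(1 - x\<^sup>2) * d0 = (N + 2 * l) * (x * p0 - p1)"
    and i1: "(1 - x\<^sup>2) * d1 = (N + 1) * (p0 - x * p1)"
    using Suc.IH unfolding N_def p0_def p1_def d0_def d1_def by auto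
  have g1: "(1 - x\<^sup>2) * d1 = (N + 1 + 2 * l) * (x * p1 - p2)"
    using i1 r by algebra
  have "(N + 1 + 2 * l) * ((1 - x\<^sup>2) * d2) = (N + 1 + 2 * l) * ((N + 2) * (p1 - x * p2))"
    using r rd i0 i1 by algebra
  then have g2: "(1 - x\<^sup>2) * d2 = (N + 2) * (p1 - x * p2)"
    using nz by (metis mult_left_cancel)
  show ?case
    using g1 g2 unfolding N_def p1_def p2_def d1_def d2_def by (simp add: algebra_simps del: gegen.simps)
qed

lemma pderiv_gegen_up:
  assumes "l > -1/2"
  shows "(1 - x\<^sup>2) * poly (pderiv (gegen l n)) x
            = (real n + 2 * l) * (x * poly (gegen l n) x - poly (gegen l (Suc n)) x)"
  using pderiv_gegen_aux[OF assms] by blast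

lemma pderiv_gegen_down:
  assumes "l > -1/2"
  shows "(1 - x\<^sup>2) * poly (pderiv (gegen l (Suc n))) x
            = (real n + 1) * (poly (gegen l n) x - x * poly (gegen l (Suc n)) x)"
  using pderiv_gegen_aux[OF assms] by blast

text \<open>The lowering relation is recorded as a polynomial \<open>p\<close> that is identically
  0, so it can be differentiated. Eliminating the neighbouring degree with both ladder relations
  gives the equation only after multiplication by 1 - x^2. That factor is cancelled in the
  polynomial ring, which also covers the points -1 and 1.\<close>

lemma gegen_ode:
  assumes l: "l > -1/2"
  shows "(1 - x\<^sup>2) * poly (pderiv (pderiv (gegen l n))) x
    - (2 * l + 1) * x * poly (pderiv (gegen l n)) x
    + real n * (real n + 2 * l) * poly (gegen l n) x = 0"
proof (cases n)
  case (Suc m)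
  define p where "p = [:1, 0, -1:] * pderiv (gegen l n)
     - smult (real m + 1) (gegen l m - [:0, 1:] * gegen l n)"
  have "poly p x = 0" for x
    using pderiv_gegen_down[OF l, of x m] unfolding p_def Suc
    by (simp add: algebra_simps power2_eq_square del: gegen.simps)
  then have "p = 0" using poly_all_0_iff_0 by blast
  define q where "q = [:1, 0, -1:] * pderiv (pderiv (gegen l n)) - [:0, 2 * l + 1:] * pderiv (gegen l n)
    + smult (real n * (real n + 2 * l)) (gegen l n)"
  have qx: "poly q x = (1 - x\<^sup>2) * poly (pderiv (pderiv (gegen l n))) x
    - (2 * l + 1) * x * poly (pderiv (gegen l n)) x
    + real n * (real n + 2 * l) * poly (gegen l n) x" for x
    unfolding q_def by (simp add: power2_eq_square algebra_simps del: gegen.simps)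
  have "poly ([:1, 0, -1:] * q) x = 0" for x
  proof -
    define N where "N = real m"
    have N: "real n = N + 1" using Suc by (simp add: N_def)
    note e1 = pderiv_gegen_up[OF l, of x m, folded Suc N_def]
    note e2 = pderiv_gegen_down[OF l, of x m, folded Suc N_def]
    have "poly (pderiv p) x = 0" using \<open>p = 0\<close> by simp
    have d: "(1 - x\<^sup>2) * poly (pderiv (pderiv (gegen l n))) x - 2 * x * poly (pderiv (gegen l n)) x
      = (N + 1) * (poly (pderiv (gegen l m)) x - poly (gegen l n) x - x * poly (pderiv (gegen l n)) x)"
      using \<open>poly (pderiv p) x = 0\<close> unfolding p_def N_def pderiv_diff pderiv_mult pderiv_smult
      by (simp add: pderiv_pCons power2_eq_square algebra_simps del: gegen.simps)
    have "(1 - x\<^sup>2) * poly q x = 0"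
      unfolding qx N using e1 e2 d by algebra
    then show ?thesis by (simp add: power2_eq_square algebra_simps)
  qed
  then have "[:1, 0, -1:] * q = 0" using poly_all_0_iff_0 by blast
  then have "q = 0" by (metis mult_eq_0_iff one_neq_zero pCons_eq_0_iff)
  then show ?thesis using qx by (metis poly_0)
qed (simp add: pderiv_1)

lemma gegen_0_eq_chebyshev: "gegen 0 n = chebyshev_poly n"
proof (induction n rule: chebyshev_poly.induct)
  case (3 n)
  have "[:0, 2 * (real n + 1):] = smult (real n + 1) [:0, 2:]" by simp
  moreover have "(2 * real n + 2) / (real n + 1) = 2" by (simp add: field_simps)
  ultimately show ?case using 3 by (simp add: smult_diff_right)
qed simp_all

text \<open>The factor is the value of the Gegenbauer polynomial at 1. It carries the whole
  degeneration at \<open>l = 0\<close>, where it vanishes for every positive degree.\<close>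

lemma gegenbauer_poly_eq:
  assumes "l > -1/2"
  shows "gegenbauer_poly l n = smult (pochhammer (2 * l) n / fact n) (gegen l n)"
  using assms
proof (induction l n rule: gegenbauer_poly.induct)
  case (3 l n)
  have nz: "real n + 1 + 2 * l \<noteq> 0" using 3 by linarith
  define c where "c = pochhammer (2 * l) n / fact n"
  have c1: "pochhammer (2 * l) (Suc n) / fact (Suc n) = c * (2 * l + n) / (real n + 1)"
    by (simp add: c_def pochhammer_Suc field_simps)
  have c2: "pochhammer (2 * l) (Suc (Suc n)) / fact (Suc (Suc n))
      = c * (2 * l + n) / (real n + 1) * (2 * l + n + 1) / (real n + 2)"
    by (simp add: c_def pochhammer_Suc field_simps)
  have "poly (gegenbauer_poly l (Suc (Suc n))) x
      = poly (smult (pochhammer (2 * l) (Suc (Suc n)) / fact (Suc (Suc n))) (gegen l (Suc (Suc n)))) x" for x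
  proof -
    define p0 p1 p2 where "p0 = poly (gegen l n) x" and "p1 = poly (gegen l (Suc n)) x"
      and "p2 = poly (gegen l (Suc (Suc n))) x"
    have r: "(real n + 1 + 2 * l) * p2 = 2 * (real n + 1 + l) * x * p1 - (real n + 1) * p0"
      unfolding p0_def p1_def p2_def using 3 by (intro gegen_rec) simp
    have i0: "poly (gegenbauer_poly l n) x = c * p0"
      using 3 by (simp add: c_def p0_def)
    have i1: "poly (gegenbauer_poly l (Suc n)) x = c * (2 * l + n) / (real n + 1) * p1"
      using 3 c1 by (simp add: p1_def)
    have "poly (gegenbauer_poly l (Suc (Suc n))) x = (1 / (real n + 2)) *
       (2 * (real n + 1 + l) * x * (c * (2 * l + n) / (real n + 1) * p1) - (real n + 2 * l) * (c * p0))"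
      using i0 i1 by (simp add: mult_ac add_ac)
    also have "\<dots> = c * (2 * l + n) / (real n + 1) / (real n + 2) *
        (2 * (real n + 1 + l) * x * p1 - (real n + 1) * p0)"
      by (simp add: divide_simps) algebra
    also have "\<dots> = c * (2 * l + n) / (real n + 1) / (real n + 2) * ((real n + 1 + 2 * l) * p2)"
      by (simp only: r)
    also have "\<dots> = c * (2 * l + n) / (real n + 1) * (2 * l + n + 1) / (real n + 2) * p2"
      by (simp add: algebra_simps)
    finally show ?thesis unfolding c2 poly_smult p2_def .
  qed
  then show ?case by (intro poly_eq_poly_eq_iff[THEN iffD1] ext)
qed simp_all

subsection \<open>Integration with Jacobi-type endpoint bounds\<close>

lemma einterval_unit:
  assumes "-1 < ereal x" "ereal x < 1"
  shows "-1 < x" "x < 1"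
proof -
  have "ereal (-1) < ereal x" "ereal x < ereal 1"
    using assms by (simp_all only: one_ereal_def uminus_ereal.simps)
  then show "-1 < x" "x < 1" by (simp_all only: less_ereal.simps)
qed

text \<open>This is the form in which integration by parts is used throughout: the positive
  exponents \<open>p\<close> and \<open>q\<close> of the envelope force both one-sided limits of
  \<open>G\<close> to be 0, so no boundary term survives.\<close>

lemma integral_deriv_eq_0:
  fixes G G' :: "real \<Rightarrow> real"
  assumes deriv: "\<And>x. -1 < x \<Longrightarrow> x < 1 \<Longrightarrow> (G has_real_derivative G' x) (at x)"
    and cont: "continuous_on {-1<..<1} G'"
    and int: "set_integrable lborel {-1<..<1} G'"
    and pq: "p > 0" "q > 0"
    and bound: "\<And>x. -1 < x \<Longrightarrow> x < 1 \<Longrightarrow> \<bar>G x\<bar> \<le> C * (1 - x) powr p * (1 + x) powr q"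
  shows "(LBINT x:{-1<..<1}. G' x) = 0"
proof -
  let ?B = "\<lambda>x. C * (1 - x) powr p * (1 + x) powr q"
  have e: "einterval (-1) 1 = {-1<..<(1::real)}"
    by (simp add: einterval_def one_ereal_def greaterThanLessThan_def greaterThan_def lessThan_def Int_def)
  have ev1: "eventually (\<lambda>x. x \<in> {-1<..<(1::real)}) (at_left 1)"
    by (rule eventually_at_leftI[of 0]) auto
  have ev2: "eventually (\<lambda>x. x \<in> {-1<..<(1::real)}) (at_right (-1))"
    by (rule eventually_at_rightI[of _ 0]) auto
  have t1: "(?B \<longlongrightarrow> C * 0 powr p * 2 powr q) (at_left 1)"
  proof (intro tendsto_mult tendsto_const tendsto_powr')
    show "0 \<noteq> (0::real) \<or> 0 < p \<and> (\<forall>\<^sub>F x in at_left (1::real). 0 \<le> 1 - x)"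
      using pq eventually_mono[OF ev1] by auto
  qed (auto intro!: tendsto_eq_intros)
  have t2: "(?B \<longlongrightarrow> C * 2 powr p * 0 powr q) (at_right (-1))"
  proof (intro tendsto_mult tendsto_const tendsto_powr')
    show "0 \<noteq> (0::real) \<or> 0 < q \<and> (\<forall>\<^sub>F x in at_right (-1::real). 0 \<le> 1 + x)"
      using pq eventually_mono[OF ev2] by auto
  qed (auto intro!: tendsto_eq_intros)
  have l1: "(G \<longlongrightarrow> 0) (at_left 1)"
  proof (rule Lim_null_comparison)
    show "\<forall>\<^sub>F x in at_left 1. norm (G x) \<le> ?B x"
      using ev1 by (rule eventually_mono) (use bound in auto)
  qed (use t1 pq in simp)
  have l2: "(G \<longlongrightarrow> 0) (at_right (-1))"
  proof (rule Lim_null_comparison)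
    show "\<forall>\<^sub>F x in at_right (-1). norm (G x) \<le> ?B x"
      using ev2 by (rule eventually_mono) (use bound in auto)
  qed (use t2 pq in simp)
  have "(LBINT x=-1..1. G' x) = 0 - 0"
  proof (rule interval_integral_FTC_integrable)
    show "(G has_vector_derivative G' x) (at x)" if "-1 < ereal x" "ereal x < 1" for x
      using deriv[of x] einterval_unit[OF that]
      by (simp add: has_real_derivative_iff_has_vector_derivative)
    show "isCont G' x" if "-1 < ereal x" "ereal x < 1" for x
      using einterval_unit[OF that] cont
      by (simp add: continuous_on_eq_continuous_at)
    show "set_integrable lborel (einterval (-1) 1) G'" using int e by simp
    show "(-1::ereal) < 1" by (simp add: one_ereal_def)
    show "((G \<circ> real_of_ereal) \<longlongrightarrow> 0) (at_right (-1))"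
      unfolding one_ereal_def uminus_ereal.simps ereal_tendsto_simps1 by (rule l2)
    show "((G \<circ> real_of_ereal) \<longlongrightarrow> 0) (at_left 1)"
      unfolding one_ereal_def ereal_tendsto_simps1 by (rule l1)
  qed
  moreover have "(-1::ereal) \<le> 1" by (simp add: one_ereal_def)
  ultimately show ?thesis
    using e by (simp add: interval_lebesgue_integral_def)
qed

lemma powr_le_1_plus_powr_2:
  fixes u a :: real
  assumes "1 \<le> u" "u \<le> 2"
  shows "u powr a \<le> 1 + 2 powr a"
proof (cases "a \<ge> 0")
  case True
  then show ?thesis using assms powr_mono2[of a u 2] by simp
next
  case False
  then have "u powr a \<le> u powr 0" using assms by (intro powr_mono) auto
  then show ?thesis using assms by (simp add: add_increasing2)
qed

lemma set_integrable_powr_left: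
  assumes "q > 0"
  shows "set_integrable lborel {-1<..<1} (\<lambda>x::real. (1 + x) powr (q - 1))"
proof -
  have e: "einterval (-1) 1 = {-1<..<(1::real)}"
    by (simp add: einterval_def one_ereal_def greaterThanLessThan_def greaterThan_def lessThan_def Int_def)
  have "set_integrable lborel (einterval (-1) 1) (\<lambda>x::real. (1 + x) powr (q - 1))"
  proof (rule interval_integral_FTC_nonneg)
    show "DERIV (\<lambda>x. (1 + x) powr q / q) x :> (1 + x) powr (q - 1)" if "-1 < ereal x" "ereal x < 1" for x
      using einterval_unit[OF that] assms by (auto intro!: derivative_eq_intros)
    show "isCont (\<lambda>x. (1 + x) powr (q - 1)) x" if "-1 < ereal x" "ereal x < 1" for x
      using einterval_unit[OF that] by (auto intro!: continuous_intros)
    have "((\<lambda>x. (1 + x) powr q / q) \<longlongrightarrow> 0 powr q / q) (at_right (-1))"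
    proof (intro tendsto_divide tendsto_const tendsto_powr')
      have "\<forall>\<^sub>F x in at_right (-1). x \<in> {-1<..<(1::real)}"
        by (rule eventually_at_rightI[of _ 0]) auto
      then have "\<forall>\<^sub>F x in at_right (-1::real). 0 \<le> 1 + x"
        by (rule eventually_mono) simp
      then show "0 \<noteq> (0::real) \<or> 0 < q \<and> (\<forall>\<^sub>F x in at_right (-1::real). 0 \<le> 1 + x)"
        using assms by simp
    qed (use assms in \<open>auto intro!: tendsto_eq_intros\<close>)
    then show "(((\<lambda>x. (1 + x) powr q / q) \<circ> real_of_ereal) \<longlongrightarrow> 0) (at_right (-1))"
      unfolding one_ereal_def uminus_ereal.simps ereal_tendsto_simps1 using assms by simp
    have "((\<lambda>x. 1 + x) \<longlongrightarrow> 2) (at_left (1::real))" by (auto intro!: tendsto_eq_intros)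
    then have "((\<lambda>x. (1 + x) powr q / q) \<longlongrightarrow> 2 powr q / q) (at_left 1)"
      using assms by (intro tendsto_divide tendsto_const tendsto_powr) auto
    then show "(((\<lambda>x. (1 + x) powr q / q) \<circ> real_of_ereal) \<longlongrightarrow> 2 powr q / q) (at_left 1)"
      unfolding one_ereal_def ereal_tendsto_simps1 .
    show "(-1::ereal) < 1" by (simp add: one_ereal_def)
  qed auto
  with e show ?thesis by simp
qed

lemma set_integral_reflect_unit:
  fixes f :: "real \<Rightarrow> real"
  shows "(LBINT x:{-1<..<1}. f (- x)) = (LBINT x:{-1<..<1}. f x)"
proof -
  have "{x. - x \<in> {-1<..<(1::real)}} = {-1<..<1}" by auto
  then show ?thesis using set_integral_reflect[of "{-1<..<(1::real)}" f] by simp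
qed

lemma set_integrable_powr_right:
  assumes "p > 0"
  shows "set_integrable lborel {-1<..<1} (\<lambda>x::real. (1 - x) powr (p - 1))"
proof -
  have "integrable lborel (\<lambda>x. indicator {-1<..<1} x *\<^sub>R (1 + x) powr (p - 1) :: real)"
    using set_integrable_powr_left[OF assms] by (simp add: set_integrable_def)
  then have "integrable lborel (\<lambda>x. indicator {-1<..<1} (0 + -1 * x) *\<^sub>R (1 + (0 + -1 * x)) powr (p - 1) :: real)"
    by (rule lborel_integrable_real_affine) simp
  moreover have "indicator {-1<..<1} (-x) = (indicator {-1<..<1} x :: real)" for x :: real
    by (auto simp: indicator_def)
  ultimately show ?thesis by (simp add: set_integrable_def)
qed

text \<open>On each half of the interval one of the two factors has its base in [1, 2] and is
  bounded by \<open>C\<close>. The sum of the two one-sided powers is therefore an integrable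
  majorant.\<close>

lemma set_integrable_powr_endpoints:
  assumes "p > 0" "q > 0"
  shows "set_integrable lborel {-1<..<1} (\<lambda>x::real. (1 - x) powr (p - 1) * (1 + x) powr (q - 1))"
proof (rule set_integrable_bound)
  define C where "C = (1 + 2 powr (p - 1)) + (1 + 2 powr (q - 1))"
  have Cpos: "C > 0" unfolding C_def by (smt (verit) powr_ge_zero)
  show "set_integrable lborel {-1<..<1} (\<lambda>x::real. C * ((1 - x) powr (p - 1) + (1 + x) powr (q - 1)))"
    by (intro set_integrable_mult_right set_integral_add set_integrable_powr_left set_integrable_powr_right assms)
  show "set_borel_measurable lborel {-1<..<1} (\<lambda>x::real. (1 - x) powr (p - 1) * (1 + x) powr (q - 1))"
    unfolding set_borel_measurable_def by measurable
  have "(1 - x) powr (p - 1) * (1 + x) powr (q - 1) \<le> C * ((1 - x) powr (p - 1) + (1 + x) powr (q - 1))"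
    if x: "-1 < x" "x < 1" for x :: real
  proof (cases "x \<ge> 0")
    case True
    have "(1 + x) powr (q - 1) \<le> C"
      using powr_le_1_plus_powr_2[of "1 + x" "q - 1"] True x powr_ge_zero[of 2 "p - 1"]
      unfolding C_def by linarith
    then have "(1 - x) powr (p - 1) * (1 + x) powr (q - 1) \<le> (1 - x) powr (p - 1) * C"
      by (rule mult_left_mono) simp
    also have "\<dots> \<le> C * ((1 - x) powr (p - 1) + (1 + x) powr (q - 1))"
      using Cpos by (simp add: distrib_left)
    finally show ?thesis .
  next
    case False
    have "(1 - x) powr (p - 1) \<le> C"
      using powr_le_1_plus_powr_2[of "1 - x" "p - 1"] False x powr_ge_zero[of 2 "q - 1"]
      unfolding C_def by linarith
    then have "(1 - x) powr (p - 1) * (1 + x) powr (q - 1) \<le> C * (1 + x) powr (q - 1)"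
      by (rule mult_right_mono) simp
    also have "\<dots> \<le> C * ((1 - x) powr (p - 1) + (1 + x) powr (q - 1))"
      using Cpos by (simp add: distrib_left)
    finally show ?thesis .
  qed
  then show "AE x in lborel. x \<in> {-1<..<1} \<longrightarrow> norm ((1 - x) powr (p - 1) * (1 + x) powr (q - 1))
      \<le> norm (C * ((1 - x) powr (p - 1) + (1 + x) powr (q - 1)))"
    using Cpos by (intro AE_I2) (simp add: abs_mult)
qed

lemma set_integrable_dominated:
  fixes f :: "real \<Rightarrow> real"
  assumes "p > 0" "q > 0" and cont: "continuous_on {-1<..<1} f"
    and bound: "\<And>x. -1 < x \<Longrightarrow> x < 1 \<Longrightarrow> \<bar>f x\<bar> \<le> C * (1 - x) powr (p - 1) * (1 + x) powr (q - 1)"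
  shows "set_integrable lborel {-1<..<1} f"
proof (rule set_integrable_bound)
  show "set_integrable lborel {-1<..<1} (\<lambda>x. C * ((1 - x) powr (p - 1) * (1 + x) powr (q - 1)))"
    by (intro set_integrable_mult_right set_integrable_powr_endpoints assms)
  show "set_borel_measurable lborel {-1<..<1} f"
    using borel_measurable_continuous_on_indicator[OF _ cont] by (simp add: set_borel_measurable_def)
  show "AE x in lborel. x \<in> {-1<..<1} \<longrightarrow> norm (f x) \<le> norm (C * ((1 - x) powr (p - 1) * (1 + x) powr (q - 1)))"
    using bound by (intro AE_I2) (force simp: mult.assoc)
qed

text \<open>A single logarithm is bounded with exponent \<open>e / m\<close>, and the bound is
  raised to the power \<open>m\<close>; the case \<open>m = 0\<close> is split off because the
  quotient would be 0 there. For y < 1 the single bound is ln t <= t - 1 at t = y powr (- d); for y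
  >= 1 the logarithm is at most 1.\<close>

lemma abs_ln_power_bound:
  fixes e :: real
  assumes "e > 0"
  obtains C where "\<And>y::real. 0 < y \<Longrightarrow> y < 2 \<Longrightarrow> \<bar>ln y\<bar> ^ m \<le> C * y powr (- e)"
proof (cases "m = 0")
  case True
  have "\<bar>ln y\<bar> ^ m \<le> 2 powr e * y powr (- e)" if "0 < y" "y < 2" for y
  proof -
    have "y powr e \<le> 2 powr e" using that assms by (intro powr_mono2) auto
    then show ?thesis using True that by (simp add: powr_minus field_simps)
  qed
  then show ?thesis by (rule that)
next
  case False
  define d where "d = e / m"
  have d: "d > 0" using assms False by (simp add: d_def)
  have md: "real m * d = e" using False by (simp add: d_def)
  define C where "C = 2 powr d + 1 / d"
  have "\<bar>ln y\<bar> ^ m \<le> C ^ m * y powr (- e)" if y: "0 < y" "y < 2" for y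
  proof -
    have "\<bar>ln y\<bar> \<le> C * y powr (- d)"
    proof (cases "y \<ge> 1")
      case True
      have "\<bar>ln y\<bar> \<le> 1" using True y ln_le_minus_one[of y] by simp
      moreover have "1 \<le> 2 powr d * y powr (- d)"
        using powr_mono2[of d y 2] y d by (simp add: powr_minus field_simps)
      moreover have "0 \<le> 1 / d * y powr (- d)" using d by simp
      ultimately show ?thesis unfolding C_def by (simp add: distrib_right)
    next
      case False
      have "ln (y powr (- d)) \<le> y powr (- d) - 1" using y by (intro ln_le_minus_one) simp
      then have "- d * ln y \<le> y powr (- d)" using y by (simp add: ln_powr)
      then have "- ln y \<le> 1 / d * y powr (- d)" using d by (simp add: field_simps)
      moreover have "0 \<le> 2 powr d * y powr (- d)" by simp
      moreover have "\<bar>ln y\<bar> = - ln y" using False y by simp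
      ultimately show ?thesis unfolding C_def distrib_right by linarith
    qed
    then have "\<bar>ln y\<bar> ^ m \<le> (C * y powr (- d)) ^ m" by (intro power_mono) auto
    also have "\<dots> = C ^ m * y powr (- e)"
      using y md by (simp add: power_mult_distrib powr_realpow[symmetric] powr_powr mult.commute)
    finally show ?thesis .
  qed
  then show ?thesis by (rule that)
qed

section \<open>The weight function and integrability against it\<close>

definition gweight :: "real \<Rightarrow> real \<Rightarrow> real" where
  "gweight l x = (1 - x\<^sup>2) powr (l - 1 / 2)"

lemma gweight_nonneg: "gweight l x \<ge> 0"
  by (simp add: gweight_def)

lemma gweight_minus: "gweight l (- x) = gweight l x"
  by (simp add: gweight_def)

lemma powr_one_minus_square:
  assumes "-1 < x" "x < (1::real)"
  shows "(1 - x\<^sup>2) powr a = (1 - x) powr a * (1 + x) powr a"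
proof -
  have "1 - x\<^sup>2 = (1 - x) * (1 + x)" by (simp add: power2_eq_square algebra_simps)
  then show ?thesis using assms by (simp add: powr_mult)
qed

lemma one_minus_square_pos: "-1 < x \<Longrightarrow> x < 1 \<Longrightarrow> 1 - x\<^sup>2 > (0::real)"
  by (metis abs_less_iff diff_gt_0_iff_gt neg_less_iff_less minus_minus power2_less_1_iff abs_square_less_1)

lemma gweight_eq: "-1 < x \<Longrightarrow> x < 1 \<Longrightarrow> gweight l x = (1 - x) powr (l - 1/2) * (1 + x) powr (l - 1/2)"
  by (simp add: gweight_def powr_one_minus_square)

lemma continuous_on_gweight: "continuous_on {-1<..<1} (gweight l)"
  unfolding gweight_def
  by (intro continuous_intros) (metis one_minus_square_pos greaterThanLessThan_iff less_irrefl)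

lemma poly_bounded_unit:
  fixes p :: "real poly"
  obtains B where "B \<ge> 0" "\<And>x. -1 < x \<Longrightarrow> x < 1 \<Longrightarrow> \<bar>poly p x\<bar> \<le> B"
proof -
  have "compact (poly p ` {-1..1})" by (intro compact_continuous_image continuous_intros) auto
  then obtain B where "\<forall>y\<in>poly p ` {-1..1}. norm y \<le> B" using compact_imp_bounded bounded_iff by metis
  then have "norm (poly p x) \<le> B" if "-1 < x" "x < 1" for x
    using that by simp
  then have "\<bar>poly p x\<bar> \<le> \<bar>B\<bar>" if "-1 < x" "x < 1" for x
    using that by (metis abs_ge_self order_trans real_norm_def)
  then show ?thesis using that[of "\<bar>B\<bar>"] by simp
qed

lemma integrable_gweight_bounded:
  assumes l: "l > -1/2" and cont: "continuous_on {-1<..<1} F"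
    and bound: "\<And>x. -1 < x \<Longrightarrow> x < 1 \<Longrightarrow> \<bar>F x\<bar> \<le> C"
  shows "set_integrable lborel {-1<..<1} (\<lambda>x. gweight l x * F x)"
proof (rule set_integrable_dominated[where C = C])
  fix x :: real assume x: "-1 < x" "x < 1"
  have "\<bar>gweight l x * F x\<bar> \<le> gweight l x * C"
    using bound[OF x] by (simp add: abs_mult gweight_nonneg mult_left_mono)
  then show "\<bar>gweight l x * F x\<bar> \<le> C * (1 - x) powr ((l + 1/2) - 1) * (1 + x) powr ((l + 1/2) - 1)"
    using x by (simp add: gweight_eq mult_ac)
qed (use l in \<open>auto intro!: continuous_on_mult continuous_on_gweight cont\<close>)

lemma integrable_gweight_poly:
  assumes l: "l > -1/2"
  shows "set_integrable lborel {-1<..<1} (\<lambda>x. gweight l x * poly p x)"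
proof -
  obtain B where "\<And>x. -1 < x \<Longrightarrow> x < 1 \<Longrightarrow> \<bar>poly p x\<bar> \<le> B" using poly_bounded_unit by metis
  then show ?thesis by (intro integrable_gweight_bounded l) (auto intro!: continuous_intros)
qed

lemma integrable_gweight_powr_ln:
  assumes l: "l > -1/2" and c: "c + l > -1/2"
  shows "set_integrable lborel {-1<..<1} (\<lambda>x. gweight l x * (poly p x * ((1 - x) powr c * ln (1 - x) ^ m)))"
proof -
  obtain B where B: "B \<ge> 0" "\<And>x. -1 < x \<Longrightarrow> x < 1 \<Longrightarrow> \<bar>poly p x\<bar> \<le> B"
    using poly_bounded_unit by metis
  \<comment> \<open>Half of the positive margin \<open>c + l + 1/2\<close> absorbs the logarithms;
    the other half keeps the singularity at 1 integrable.\<close>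
  define e where "e = (c + l + 1/2) / 2"
  have e: "e > 0" using c by (simp add: e_def)
  obtain C where C: "\<And>y::real. 0 < y \<Longrightarrow> y < 2 \<Longrightarrow> \<bar>ln y\<bar> ^ m \<le> C * y powr (- e)"
    using abs_ln_power_bound[OF e] by metis
  show ?thesis
  proof (rule set_integrable_dominated[where C = "B * C" and p = e and q = "l + 1/2"])
    fix x :: real assume x: "-1 < x" "x < 1"
    have "\<bar>gweight l x * (poly p x * ((1 - x) powr c * ln (1 - x) ^ m))\<bar>
        = gweight l x * (1 - x) powr c * (\<bar>poly p x\<bar> * \<bar>ln (1 - x)\<bar> ^ m)"
      by (simp add: abs_mult gweight_nonneg power_abs)
    also have "\<dots> \<le> gweight l x * (1 - x) powr c * (B * (C * (1 - x) powr (- e)))"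
      using x B C[of "1 - x"] by (intro mult_left_mono mult_mono) (auto simp: gweight_nonneg)
    also have "\<dots> = B * C * ((1 - x) powr (l - 1/2) * (1 - x) powr c * (1 - x) powr (- e)) * (1 + x) powr ((l + 1/2) - 1)"
      using x by (simp add: gweight_eq mult_ac)
    also have "(1 - x) powr (l - 1/2) * (1 - x) powr c * (1 - x) powr (- e) = (1 - x) powr (e - 1)"
      unfolding powr_add[symmetric] by (rule arg_cong[where f = "\<lambda>u. _ powr u"]) (simp add: e_def field_simps)
    finally show "\<bar>gweight l x * (poly p x * ((1 - x) powr c * ln (1 - x) ^ m))\<bar>
       \<le> B * C * (1 - x) powr (e - 1) * (1 + x) powr (l + 1/2 - 1)" .
  qed (use l e in \<open>auto intro!: continuous_intros continuous_on_gweight\<close>)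
qed

subsection \<open>Logarithmic moments\<close>

definition gegen_moment :: "real \<Rightarrow> real \<Rightarrow> nat \<Rightarrow> nat \<Rightarrow> real" where
  "gegen_moment l c n m =
     (LBINT x:{-1<..<1}. gweight l x * (poly (gegen l n) x * ((1 - x) powr c * ln (1 - x) ^ m)))"

text \<open>The integrated identity is the derivative of
  \<open>(1 - x) powr (c + l + 1/2) * (1 + x) powr (l - 1/2) * S x * ln (1 - x) ^ m\<close> with \<open>S = P\<^sub>n + P\<^sub>n\<^sub>+\<^sub>1\<close>;
  this vanishes at \<open>-1\<close> because \<open>S (-1) = 0\<close>.\<close>
lemma gegen_moment_rec:
  assumes l: "l > -1/2" and c: "c + l > -1/2"
  shows "(real n + (c + 2 * l + 1)) * gegen_moment l c (Suc n) m
    = (real n - c) * gegen_moment l c n m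
      - real m * (gegen_moment l c n (m - 1) + gegen_moment l c (Suc n) (m - 1))"
proof -
  define S where "S = gegen l n + gegen l (Suc n)"
  define H where "H = (\<lambda>n m x. gweight l x * (poly (gegen l n) x * ((1 - x) powr c * ln (1 - x) ^ m)))"
  define G where "G = (\<lambda>x. (1 - x) powr (c + l + 1/2) * (1 + x) powr (l - 1/2) * (poly S x * ln (1 - x) ^ m))"
  \<comment> \<open>At \<open>m = 0\<close> the truncated index \<open>m - 1\<close> is again 0, but
    its terms are multiplied by \<open>real m = 0\<close>.\<close>
  define G' where "G' = (\<lambda>x. (real n - c) * H n m x - (real n + (c + 2 * l + 1)) * H (Suc n) m x
      - real m * (H n (m - 1) x + H (Suc n) (m - 1) x))"
  have int: "set_integrable lborel {-1<..<1} (H n m)" for n m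
    unfolding H_def by (rule integrable_gweight_powr_ln[OF l c])
  have cont: "continuous_on {-1<..<1} (H n m)" for n m
    unfolding H_def by (intro continuous_intros continuous_on_gweight) auto
  have "poly S (-1) = 0"
    unfolding S_def by (simp add: gegen_at_minus_1[OF l] del: gegen.simps)
  \<comment> \<open>Dividing out the zero at -1 raises the exponent of \<open>1 + x\<close> in
    \<open>G\<close> from \<open>l - 1/2\<close>, which may be negative, to the positive
    \<open>l + 1/2\<close>.\<close>
  then have "[:1, 1:] dvd S" by (simp add: poly_eq_0_iff_dvd)
  then obtain Z where Z: "S = [:1, 1:] * Z" by (auto simp: dvd_def)
  obtain B where B: "B \<ge> 0" "\<And>x. -1 < x \<Longrightarrow> x < 1 \<Longrightarrow> \<bar>poly Z x\<bar> \<le> B"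
    using poly_bounded_unit by metis
  define e where "e = (c + l + 1/2) / 2"
  have e: "e > 0" using c by (simp add: e_def)
  obtain C where C: "\<And>y::real. 0 < y \<Longrightarrow> y < 2 \<Longrightarrow> \<bar>ln y\<bar> ^ m \<le> C * y powr (- e)"
    using abs_ln_power_bound[OF e] by metis
  have "(LBINT x:{-1<..<1}. G' x) = 0"
  proof (rule integral_deriv_eq_0[where G = G and C = "B * C" and p = e and q = "l + 1/2"])
    show "continuous_on {-1<..<1} G'" unfolding G'_def by (intro continuous_intros cont)
    show "set_integrable lborel {-1<..<1} G'" unfolding G'_def
      by (intro set_integral_diff set_integral_add set_integrable_mult_right int)
    show "e > 0" "l + 1/2 > 0" using e l by auto
    fix x :: real assume x: "-1 < x" "x < 1"
    have x1: "(1 + x) powr (l + 1/2) = (1 + x) powr (l - 1/2) * (1 + x)"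
      using x powr_add[of "1 + x" "l - 1/2" 1] by (simp add: add.commute)
    have "\<bar>G x\<bar> = (1 - x) powr (c + l + 1/2) * (1 + x) powr (l + 1/2) * (\<bar>poly Z x\<bar> * \<bar>ln (1 - x)\<bar> ^ m)"
    proof -
      have "poly S x = (1 + x) * poly Z x" unfolding Z by (simp add: algebra_simps)
      then show ?thesis
        unfolding G_def x1 using x by (simp add: abs_mult power_abs)
    qed
    also have "\<dots> \<le> (1 - x) powr (c + l + 1/2) * (1 + x) powr (l + 1/2) * (B * (C * (1 - x) powr (- e)))"
      using x B C[of "1 - x"] by (intro mult_left_mono mult_mono) auto
    also have "\<dots> = B * C * ((1 - x) powr (c + l + 1/2) * (1 - x) powr (- e)) * (1 + x) powr (l + 1/2)"
      by (simp add: mult_ac)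
    also have "(1 - x) powr (c + l + 1/2) * (1 - x) powr (- e) = (1 - x) powr e"
      unfolding powr_add[symmetric] by (rule arg_cong[where f = "\<lambda>u. _ powr u"]) (simp add: e_def field_simps)
    finally show "\<bar>G x\<bar> \<le> B * C * (1 - x) powr e * (1 + x) powr (l + 1/2)" .
    define p0 p1 s' where "p0 = poly (gegen l n) x" and "p1 = poly (gegen l (Suc n)) x"
      and "s' = poly (pderiv S) x"
    have s: "poly S x = p0 + p1" by (simp add: S_def p0_def p1_def)
    have s': "(1 - x\<^sup>2) * s' = (real n + 2 * l) * (x * p0 - p1) + (real n + 1) * (p0 - x * p1)"
      using pderiv_gegen_up[OF l, of x n] pderiv_gegen_down[OF l, of x n]
      unfolding s'_def S_def p0_def p1_def pderiv_add by (simp add: distrib_left del: gegen.simps)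
    define L where "L = ln (1 - x)"
    \<comment> \<open>Expressing every power through the lowest ones, \<open>A\<close> and
      \<open>D\<close>, times linear factors turns the derivative identity into an algebraic one.
      The only remaining quotient is the one named \<open>w\<close> below.\<close>
    define A where "A = (1 - x) powr (c + l - 1/2)"
    define D where "D = (1 + x) powr (l - 3/2)"
    have A: "(1 - x) powr (c + l + 1/2) = A * (1 - x)"
      using x powr_add[of "1 - x" "c + l - 1/2" 1] by (simp add: A_def algebra_simps)
    have D: "(1 + x) powr (l - 1/2) = D * (1 + x)"
      using x powr_add[of "1 + x" "l - 3/2" 1] by (simp add: D_def add.commute)
    have H: "H k j x = A * D * (1 + x) * (poly (gegen l k) x * L ^ j)" for k j
    proof -
      have "(1 - x) powr (l - 1/2) * (1 - x) powr c = A"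
        unfolding A_def powr_add[symmetric] by (simp add: algebra_simps)
      then show ?thesis
        using D x unfolding H_def L_def[symmetric] by (simp add: gweight_eq)
    qed
    have d1: "((\<lambda>x. (1 - x) powr (c + l + 1/2)) has_real_derivative (- (c + l + 1/2)) * A) (at x)"
      using x unfolding A_def by (auto intro!: derivative_eq_intros simp: algebra_simps)
    have d2: "((\<lambda>x. (1 + x) powr (l - 1/2)) has_real_derivative (l - 1/2) * D) (at x)"
      using x unfolding D_def by (auto intro!: derivative_eq_intros)
    have d3: "((\<lambda>x. ln (1 - x) ^ m) has_real_derivative - (real m * L ^ (m - 1) / (1 - x))) (at x)"
      using x unfolding L_def by (auto intro!: derivative_eq_intros)
    have d4: "(poly S has_real_derivative s') (at x)"
      unfolding s'_def by (rule poly_DERIV)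
    have "(G has_real_derivative
       ((- (c + l + 1/2)) * A * (D * (1 + x)) + (l - 1/2) * D * (A * (1 - x))) * ((p0 + p1) * L ^ m)
        + (s' * L ^ m + - (real m * L ^ (m - 1) / (1 - x)) * (p0 + p1)) * (A * (1 - x) * (D * (1 + x)))) (at x)"
      using DERIV_mult[OF DERIV_mult[OF d1 d2] DERIV_mult[OF d4 d3]]
      unfolding G_def A D s L_def[symmetric] .
    moreover have "((- (c + l + 1/2)) * A * (D * (1 + x)) + (l - 1/2) * D * (A * (1 - x))) * ((p0 + p1) * L ^ m)
        + (s' * L ^ m + - (real m * L ^ (m - 1) / (1 - x)) * (p0 + p1)) * (A * (1 - x) * (D * (1 + x))) = G' x"
    proof -
      define Lm Lk where "Lm = L ^ m" and "Lk = real m * L ^ (m - 1)"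
      define w where "w = Lk / (1 - x)"
      have w: "w * (1 - x) = Lk" using x by (simp add: w_def)
      have G': "G' x = A * D * (1 + x) * (((real n - c) * p0 - (real n + (c + 2 * l + 1)) * p1) * Lm - Lk * (p0 + p1))"
        unfolding G'_def H p0_def[symmetric] p1_def[symmetric] Lm_def Lk_def by (simp add: algebra_simps)
      have "((- (c + l + 1/2)) * A * (D * (1 + x)) + (l - 1/2) * D * (A * (1 - x))) * ((p0 + p1) * Lm)
        + (s' * Lm + - w * (p0 + p1)) * (A * (1 - x) * (D * (1 + x)))
        = A * D * (((- (c + l + 1/2)) * (1 + x) + (l - 1/2) * (1 - x)) * (p0 + p1) * Lm
          + ((1 - x\<^sup>2) * s') * Lm - (w * (1 - x)) * (p0 + p1) * (1 + x))"
        by (simp add: algebra_simps power2_eq_square)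
      also have "\<dots> = G' x"
        unfolding s' w G' by (simp add: field_simps)
      finally show ?thesis unfolding Lm_def w_def Lk_def .
    qed
    ultimately show "(G has_real_derivative G' x) (at x)" by simp
  qed
  moreover have mom: "gegen_moment l c k j = (LBINT x:{-1<..<1}. H k j x)" for k j
    by (simp add: gegen_moment_def H_def)
  have "(LBINT x:{-1<..<1}. G' x) = (real n - c) * gegen_moment l c n m
      - (real n + (c + 2 * l + 1)) * gegen_moment l c (Suc n) m
      - real m * (gegen_moment l c n (m - 1) + gegen_moment l c (Suc n) (m - 1))"
    unfolding G'_def mom using int by (simp add: set_integral_diff set_integral_add)
  ultimately show ?thesis by linarith
qed

section \<open>Harmonic sums and products of shifted ratios\<close>

lemma ln_ge_1:
  assumes "n \<ge> 3"
  shows "ln (real n) \<ge> 1"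
proof -
  have "exp 1 \<le> real n" using exp_le assms by linarith
  then have "ln (exp 1) \<le> ln (real n)" by (subst ln_le_cancel_iff) (use assms in auto)
  then show ?thesis by simp
qed

text \<open>The upper bound comes from the decrease of the harmonic numbers minus the logarithm, the
  lower one from telescoping ln (k + 1) - ln k <= 1 / k.\<close>

lemma sum_inverse_bounds:
  assumes "1 \<le> k0" "k0 \<le> n"
  shows "(\<Sum>k=k0..<n. 1 / real k) \<le> ln (real n) + 1"
    and "ln (real n) - ln (real k0) \<le> (\<Sum>k=k0..<n. 1 / real k)"
proof -
  have "(\<Sum>k=k0..<n. 1 / real k) \<le> (\<Sum>k=1..n. 1 / real k)"
    using assms by (intro sum_mono2) auto
  also have "\<dots> = harm n" by (simp add: harm_def inverse_eq_divide)
  also have "\<dots> \<le> ln (real n) + 1"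
  proof -
    obtain j where j: "n = Suc j" using assms by (cases n) auto
    have "harm (Suc j) - ln (real (Suc j)) \<le> harm (Suc 0) - ln (real (Suc 0))"
      using decseqD[OF decseq_harm_diff_ln, of 0 j] by simp
    then show ?thesis using j by (simp add: harm_expand)
  qed
  finally show "(\<Sum>k=k0..<n. 1 / real k) \<le> ln (real n) + 1" .
  show "ln (real n) - ln (real k0) \<le> (\<Sum>k=k0..<n. 1 / real k)"
    using assms(2)
  proof (induction n rule: dec_induct)
    case (step n)
    have "ln (real (Suc n)) - ln (real n) \<le> (real (Suc n) - real n) / real n"
      using step assms by (intro ln_diff_le) auto
    then show ?case using step by simp
  qed simp
qed

text \<open>For k > c the factor is 1 - (c + b - 2 r) / (k + b - r), so the logarithm of the product
  is at most - (c + b) times a harmonic sum, up to bounded errors. The choice r = r0 / ln n keeps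
  the contribution of 2 r times that sum bounded. The finitely many earlier factors give a constant,
  except that for natural c the factor at k = c has numerator r and supplies the extra 1 / ln
  n.\<close>

lemma prod_shifted_ratio_bound:
  fixes b c :: real
  assumes b: "b > 0"
  shows "\<exists>r0>0. r0 \<le> 1 \<and> r0 < b \<and> (\<exists>(N::nat) C. 3 \<le> N \<and> (\<forall>n\<ge>N.
    (\<Prod>k<n. (\<bar>real k - c\<bar> + r0 / ln (real n)) / (real k + b - r0 / ln (real n)))
        \<le> C * real n powr (- (c + b)) * (if c \<in> \<nat> then 1 / ln (real n) else 1)))"
proof -
  \<comment> \<open>The bound \<open>b / 2\<close> keeps every denominator, including the one at k =
    0, at least \<open>b / 2\<close>.\<close>
  define r0 where "r0 = min 1 (b / 2)"
  define s where "s = c + b"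
  \<comment> \<open>From \<open>k0\<close> on, \<open>k - c\<close> is positive and the absolute
    value disappears; \<open>k0 >= 1\<close> also makes 1 / k meaningful.\<close>
  define k0 where "k0 = nat \<lceil>c\<rceil> + 1"
  have k0: "k0 \<ge> 1" "real k0 > c" unfolding k0_def by (auto, linarith)
  define Z where "Z = (\<Sum>k. inverse (real k ^ 2))"
  \<comment> \<open>\<open>D\<close> bounds the early factors after the possible 1 / ln n at k = c
    has been split off. In \<open>E\<close> the three terms come from comparing the harmonic sum
    with ln n, from replacing \<open>k + b - r\<close> by k, and from 2 r (ln n + 1) <= 4.\<close>
  define D where "D = (\<Prod>k<k0. (if real k = c then 1 else \<bar>real k - c\<bar> + 1) / (b / 2))"
  define E where "E = \<bar>s\<bar> * (1 + ln (real k0)) + \<bar>s\<bar> * b * Z + 4"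
  have r0: "r0 > 0" "r0 \<le> 1" "r0 < b" using b by (auto simp: r0_def)
  have "(\<Prod>k<n. (\<bar>real k - c\<bar> + r0 / ln (real n)) / (real k + b - r0 / ln (real n)))
        \<le> D * exp E * real n powr (- (c + b)) * (if c \<in> \<nat> then 1 / ln (real n) else 1)"
    if n: "n \<ge> max 3 k0" for n :: nat
  proof -
    have ln1: "ln (real n) \<ge> 1" using n by (intro ln_ge_1) simp
    define r where "r = r0 / ln n"
    have r: "r > 0" "r \<le> 1" "r \<le> b / 2" "r * ln n \<le> 1" "r \<le> 1 / ln n"
    proof -
      have "r \<le> r0" unfolding r_def using ln1 b frac_le[of r0 r0 1 "ln n"] by (simp add: r0_def)
      then show "r \<le> 1" "r \<le> b / 2" by (auto simp: r0_def)
      show "r > 0" "r * ln n \<le> 1" "r \<le> 1 / ln n" 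
        using ln1 b unfolding r_def by (auto simp: r0_def divide_right_mono)
    qed
    define f where "f = (\<lambda>k. (\<bar>real k - c\<bar> + r) / (real k + b - r))"
    have fnn: "f k \<ge> 0" for k unfolding f_def using r b by (intro divide_nonneg_nonneg) auto
    have "(\<Prod>k<k0. f k) \<le> (\<Prod>k<k0. (if real k = c then 1 else \<bar>real k - c\<bar> + 1) / (b / 2) * (if real k = c then 1 / ln n else 1))"
    proof (rule prod_mono, intro conjI fnn)
      fix k
      have "f k \<le> (\<bar>real k - c\<bar> + r) / (b / 2)"
        unfolding f_def using r b by (intro divide_left_mono) (auto intro!: mult_pos_pos)
      also have "\<dots> \<le> (if real k = c then 1 else \<bar>real k - c\<bar> + 1) * (if real k = c then 1 / ln n else 1) / (b / 2)"
        using r b by (intro divide_right_mono) auto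
      finally show "f k \<le> (if real k = c then 1 else \<bar>real k - c\<bar> + 1) / (b / 2) * (if real k = c then 1 / ln n else 1)"
        by (simp only: times_divide_eq_left)
    qed
    also have "\<dots> = D * (\<Prod>k<k0. if real k = c then 1 / ln n else 1)"
      unfolding D_def by (rule prod.distrib)
    also have "(\<Prod>k<k0. if real k = c then 1 / ln n else 1) = (if c \<in> \<nat> then 1 / ln n else 1)"
    proof (cases "c \<in> \<nat>")
      case True
      then obtain j where j: "c = real j" by (auto elim: Nats_cases)
      then have "j < k0" using k0 by simp
      then show ?thesis using j True by (simp add: prod.delta)
    next
      case False
      then have "real k \<noteq> c" for k by auto
      then show ?thesis using False by simp
    qed
    finally have part1: "(\<Prod>k<k0. f k) \<le> D * (if c \<in> \<nat> then 1 / ln n else 1)" .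
    have "(\<Prod>k=k0..<n. f k) \<le> (\<Prod>k=k0..<n. exp (- s * (1 / real k) + \<bar>s\<bar> * b * inverse (real k ^ 2) + 2 * r * (1 / real k)))"
    proof (rule prod_mono, intro conjI fnn)
      fix k assume "k \<in> {k0..<n}"
      then have k: "real k \<ge> 1" "real k > c" using k0 by auto
      define d where "d = real k + b - r"
      have d: "d \<ge> real k" "d > 0" using r k b by (auto simp: d_def)
      have "f k = 1 - (s - 2 * r) / d"
        unfolding f_def d_def[symmetric] using d k by (simp add: field_simps) (simp add: s_def d_def)
      also have "\<dots> \<le> exp (- ((s - 2 * r) / d))"
        using exp_ge_add_one_self[of "- ((s - 2 * r) / d)"] by simp
      also have "\<dots> \<le> exp (- s * (1 / real k) + \<bar>s\<bar> * b * inverse (real k ^ 2) + 2 * r * (1 / real k))"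
      proof -
        have "2 * r / d \<le> 2 * r / real k" using r d k by (intro divide_left_mono) auto
        \<comment> \<open>The difference equals s (b - r) / (k d), which is of order 1 / k^2 and
          hence summable uniformly in n; the absolute value of \<open>s\<close> covers both
          signs.\<close>
        moreover have "s / real k - s / d \<le> \<bar>s\<bar> * b * inverse (real k ^ 2)"
        proof -
          have "s / real k - s / d = s * ((b - r) / (real k * d))"
            using d k by (simp add: field_simps) (simp add: d_def algebra_simps)
          also have "\<dots> \<le> \<bar>s\<bar> * ((b - r) / (real k * d))"
            using r b d k by (intro mult_right_mono) auto
          also have "(b - r) / (real k * d) \<le> b / (real k * real k)"
            using r b d k by (intro frac_le mult_left_mono) auto
          then have "\<bar>s\<bar> * ((b - r) / (real k * d)) \<le> \<bar>s\<bar> * (b / (real k * real k))"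
            by (intro mult_left_mono) auto
          finally show ?thesis by (simp add: power2_eq_square divide_inverse)
        qed
        ultimately show ?thesis by (simp add: diff_divide_distrib)
      qed
      finally show "f k \<le> exp (- s * (1 / real k) + \<bar>s\<bar> * b * inverse (real k ^ 2) + 2 * r * (1 / real k))" .
    qed
    also have "\<dots> = exp (- s * (\<Sum>k=k0..<n. 1 / real k) + \<bar>s\<bar> * b * (\<Sum>k=k0..<n. inverse (real k ^ 2))
        + 2 * r * (\<Sum>k=k0..<n. 1 / real k))"
      by (simp add: exp_sum[symmetric] sum.distrib sum_distrib_left sum_subtractf sum_negf)
    also have "\<dots> \<le> exp (- s * ln n + E)"
    proof -
      define H where "H = (\<Sum>k=k0..<n. 1 / real k)"
      have H: "H \<le> ln n + 1" "ln n - ln k0 \<le> H"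
        using sum_inverse_bounds[of k0 n] n k0 by (auto simp: H_def)
      have "ln (real k0) \<ge> 0" using k0 by simp
      with H have "\<bar>ln n - H\<bar> \<le> 1 + ln k0" by linarith
      then have "\<bar>s\<bar> * \<bar>ln n - H\<bar> \<le> \<bar>s\<bar> * (1 + ln k0)" by (intro mult_left_mono) auto
      moreover have "s * (ln n - H) \<le> \<bar>s\<bar> * \<bar>ln n - H\<bar>" by (simp only: abs_mult[symmetric] abs_ge_self)
      ultimately have "s * (ln n - H) \<le> \<bar>s\<bar> * (1 + ln k0)" by linarith
      then have 1: "- s * H \<le> - s * ln n + \<bar>s\<bar> * (1 + ln k0)" by (simp add: algebra_simps)
      have "(\<Sum>k=k0..<n. inverse (real k ^ 2)) \<le> Z"
        unfolding Z_def by (intro sum_le_suminf inverse_power_summable) auto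
      then have 2: "\<bar>s\<bar> * b * (\<Sum>k=k0..<n. inverse (real k ^ 2)) \<le> \<bar>s\<bar> * b * Z"
        using b by (intro mult_left_mono) auto
      have "2 * r * H \<le> 2 * r * (ln n + 1)" using H r by (intro mult_left_mono) auto
      also have "\<dots> \<le> 4" using r by (simp add: algebra_simps)
      finally have 3: "2 * r * H \<le> 4" .
      show ?thesis using 1 2 3 unfolding H_def[symmetric] E_def exp_le_cancel_iff by linarith
    qed
    also have "\<dots> = exp E * real n powr (- s)"
      using n by (simp add: exp_add[symmetric] powr_def)
    finally have part2: "(\<Prod>k=k0..<n. f k) \<le> exp E * real n powr (- s)" .
    have "{..<n} = {..<k0} \<union> {k0..<n}" using n by auto
    moreover have "prod f ({..<k0} \<union> {k0..<n}) = prod f {..<k0} * prod f {k0..<n}"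
      by (rule prod.union_disjoint) auto
    ultimately have "(\<Prod>k<n. f k) = (\<Prod>k<k0. f k) * (\<Prod>k=k0..<n. f k)" by simp
    also have "\<dots> \<le> (D * (if c \<in> \<nat> then 1 / ln n else 1)) * (exp E * real n powr (- s))"
    proof (rule mult_mono[OF part1 part2])
      have "0 \<le> (\<Prod>k<k0. f k)" by (intro prod_nonneg fnn)
      then show "0 \<le> D * (if c \<in> \<nat> then 1 / ln n else 1)" using part1 by linarith
      show "0 \<le> (\<Prod>k=k0..<n. f k)" by (intro prod_nonneg fnn)
    qed
    finally show ?thesis
      unfolding f_def r_def s_def by (simp only: mult_ac)
  qed
  then show ?thesis
    using r0 by (intro exI[of _ r0] conjI exI[of _ "max 3 k0"] exI[of _ "D * exp E"]) auto
qed

text \<open>Since m / m! = 1 / (m - 1)!, lowering the index in the exponential generating sum costs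
  exactly one factor \<open>r\<close>. This is what lets the lower-order terms of the moment
  recurrence be measured by the same weighted sum.\<close>

lemma sum_shift_weighted:
  fixes a :: "nat \<Rightarrow> real"
  shows "(\<Sum>m\<le>Suc M. real m * a (m - 1) * r ^ m / fact m) = r * (\<Sum>m\<le>M. a m * r ^ m / fact m)"
proof (induction M)
  case (Suc M)
  have "real (Suc (Suc M)) * a (Suc (Suc M) - 1) * r ^ Suc (Suc M) / fact (Suc (Suc M))
      = r * (a (Suc M) * r ^ Suc M / fact (Suc M))"
    by (simp add: divide_simps)
  then show ?case
    using Suc by (simp only: sum.atMost_Suc[of _ "Suc M"] sum.atMost_Suc[of "\<lambda>m. a m * r ^ m / fact m" M] distrib_left)
qed simp

text \<open>The left-hand side majorises the generating function \<open>\<Sum>m. r\<^sup>m / m! \<integral> w P\<^sub>n y\<^sup>c ln\<^sup>m y\<close>, i.e. the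
  moment with exponent \<open>c + r\<close>; it is used with \<open>r\<close> of order \<open>1 / ln n\<close>.\<close>
lemma gegen_moment_sum_bound:
  assumes l: "l > -1/2" and c: "c + l > -1/2" and r: "r > 0" "r \<le> 1" "r < c + 2 * l + 1"
  shows "(\<Sum>m\<le>M. \<bar>gegen_moment l c n m\<bar> * r ^ m / fact m)
    \<le> (\<Sum>m\<le>M. \<bar>gegen_moment l c 0 m\<bar>) * (\<Prod>k<n. (\<bar>real k - c\<bar> + r) / (real k + (c + 2 * l + 1) - r))"
proof (induction n)
  case 0
  have "\<bar>gegen_moment l c 0 m\<bar> * r ^ m / fact m \<le> \<bar>gegen_moment l c 0 m\<bar> * 1 / 1" for m
    using r by (intro frac_le mult_left_mono power_le_one) (auto simp: fact_ge_1)
  then show ?case by (simp add: sum_mono)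
next
  case (Suc n)
  define b where "b = c + 2 * l + 1"
  define S where "S = (\<lambda>n. \<Sum>m\<le>M. \<bar>gegen_moment l c n m\<bar> * r ^ m / fact m)"
  have shift: "(\<Sum>m\<le>M. real m * a (m - 1) * r ^ m / fact m) \<le> r * (\<Sum>m\<le>M. a m * r ^ m / fact m)"
    if a: "\<And>m. a m \<ge> 0" for a :: "nat \<Rightarrow> real"
  proof -
    have "(\<Sum>m\<le>M. real m * a (m - 1) * r ^ m / fact m) \<le> (\<Sum>m\<le>Suc M. real m * a (m - 1) * r ^ m / fact m)"
      using a r by (intro sum_mono2) auto
    then show ?thesis by (simp only: sum_shift_weighted)
  qed
  have b: "real n + b - r > 0" using r by (simp add: b_def)
  have "(real n + b) * \<bar>gegen_moment l c (Suc n) m\<bar> \<le> \<bar>real n - c\<bar> * \<bar>gegen_moment l c n m\<bar>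
      + real m * (\<bar>gegen_moment l c n (m - 1)\<bar> + \<bar>gegen_moment l c (Suc n) (m - 1)\<bar>)" for m
  proof -
    have "(real n + b) * \<bar>gegen_moment l c (Suc n) m\<bar> = \<bar>(real n + b) * gegen_moment l c (Suc n) m\<bar>"
      using b r by (simp add: abs_mult)
    also have "\<dots> \<le> \<bar>(real n - c) * gegen_moment l c n m\<bar>
        + \<bar>real m * (gegen_moment l c n (m - 1) + gegen_moment l c (Suc n) (m - 1))\<bar>"
      unfolding b_def gegen_moment_rec[OF l c] by (rule abs_triangle_ineq4)
    also have "\<bar>real m * (gegen_moment l c n (m - 1) + gegen_moment l c (Suc n) (m - 1))\<bar>
        \<le> real m * (\<bar>gegen_moment l c n (m - 1)\<bar> + \<bar>gegen_moment l c (Suc n) (m - 1)\<bar>)"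
      by (simp add: abs_mult mult_left_mono abs_triangle_ineq)
    finally show ?thesis by (simp add: abs_mult)
  qed
  then have "(real n + b) * \<bar>gegen_moment l c (Suc n) m\<bar> * (r ^ m / fact m) \<le> (\<bar>real n - c\<bar> * \<bar>gegen_moment l c n m\<bar>
      + real m * (\<bar>gegen_moment l c n (m - 1)\<bar> + \<bar>gegen_moment l c (Suc n) (m - 1)\<bar>)) * (r ^ m / fact m)" for m
    using r by (intro mult_right_mono) auto
  then have "(\<Sum>m\<le>M. (real n + b) * \<bar>gegen_moment l c (Suc n) m\<bar> * (r ^ m / fact m))
     \<le> (\<Sum>m\<le>M. (\<bar>real n - c\<bar> * \<bar>gegen_moment l c n m\<bar>
      + real m * (\<bar>gegen_moment l c n (m - 1)\<bar> + \<bar>gegen_moment l c (Suc n) (m - 1)\<bar>)) * (r ^ m / fact m))"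
    by (intro sum_mono)
  also have "\<dots> = \<bar>real n - c\<bar> * S n + (\<Sum>m\<le>M. real m * \<bar>gegen_moment l c n (m - 1)\<bar> * r ^ m / fact m)
      + (\<Sum>m\<le>M. real m * \<bar>gegen_moment l c (Suc n) (m - 1)\<bar> * r ^ m / fact m)"
    by (simp add: S_def sum.distrib[symmetric] sum_distrib_left algebra_simps add_divide_distrib)
  also have "\<dots> \<le> \<bar>real n - c\<bar> * S n + r * S n + r * S (Suc n)"
    unfolding S_def using shift[of "\<lambda>m. \<bar>gegen_moment l c n m\<bar>"] shift[of "\<lambda>m. \<bar>gegen_moment l c (Suc n) m\<bar>"]
    by linarith
  also have "(\<Sum>m\<le>M. (real n + b) * \<bar>gegen_moment l c (Suc n) m\<bar> * (r ^ m / fact m)) = (real n + b) * S (Suc n)"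
    by (simp add: S_def sum_distrib_left mult.assoc)
  finally have "(real n + b) * S (Suc n) \<le> (\<bar>real n - c\<bar> + r) * S n + r * S (Suc n)"
    by (simp add: algebra_simps)
  \<comment> \<open>The lower moments of degree \<open>Suc n\<close> put
    \<open>r * S (Suc n)\<close> on the right; absorbing it on the left turns the coefficient
    \<open>n + b\<close> into \<open>n + b - r\<close>.\<close>
  then have "(real n + b - r) * S (Suc n) \<le> (\<bar>real n - c\<bar> + r) * S n" by (simp add: algebra_simps)
  then have "S (Suc n) \<le> (\<bar>real n - c\<bar> + r) / (real n + b - r) * S n"
    using b by (simp add: field_simps)
  also have "\<dots> \<le> (\<bar>real n - c\<bar> + r) / (real n + b - r)
     * ((\<Sum>m\<le>M. \<bar>gegen_moment l c 0 m\<bar>) * (\<Prod>k<n. (\<bar>real k - c\<bar> + r) / (real k + (c + 2 * l + 1) - r)))"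
    using Suc.IH r b unfolding S_def by (intro mult_left_mono divide_nonneg_nonneg) auto
  finally show ?case by (simp add: S_def b_def mult_ac)
qed

text \<open>Keeping only the top term of the weighted sum means dividing by r^M / M!, and with r =
  r0 / ln n this division costs M logarithms. For natural c the product bound returns one of
  them.\<close>

lemma gegen_moment_bigo:
  assumes l: "l > -1/2" and c: "c + l > -1/2" and M: "M \<ge> 1"
  shows "(\<lambda>n. gegen_moment l c n M)
    \<in> O(\<lambda>n. ln (real n) ^ (if c \<in> \<nat> then M - 1 else M) * real n powr (- 2 * c - 2 * l - 1))"
proof -
  \<comment> \<open>It is positive as the sum of \<open>c + l + 1/2\<close> and
    \<open>l + 1/2\<close>, and \<open>c + b\<close> is the decay exponent
    \<open>2 * c + 2 * l + 1\<close>.\<close>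
  define b where "b = c + 2 * l + 1"
  have b: "b > 0" using l c by (simp add: b_def)
  obtain r0 N C where r0: "r0 > 0" "r0 \<le> 1" "r0 < b" and N: "3 \<le> (N::nat)"
    and C: "\<And>n. n \<ge> N \<Longrightarrow> (\<Prod>k<n. (\<bar>real k - c\<bar> + r0 / ln (real n)) / (real k + b - r0 / ln (real n)))
        \<le> C * real n powr (- (c + b)) * (if c \<in> \<nat> then 1 / ln (real n) else 1)"
    using prod_shifted_ratio_bound[OF b, of c] by blast
  define K where "K = (\<Sum>m\<le>M. \<bar>gegen_moment l c 0 m\<bar>)"
  have K: "K \<ge> 0" by (simp add: K_def sum_nonneg)
  define A where "A = fact M / r0 ^ M * K * C"
  have "norm (gegen_moment l c n M) \<le> A * norm (ln (real n) ^ (if c \<in> \<nat> then M - 1 else M) * real n powr (- 2 * c - 2 * l - 1))"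
    if n: "n \<ge> N" for n
  proof -
    have ln1: "ln (real n) \<ge> 1" using n N by (intro ln_ge_1) simp
    define r where "r = r0 / ln n"
    have "r \<le> r0" using ln1 r0 frac_le[of r0 r0 1 "ln n"] by (simp add: r_def)
    then have r: "r > 0" "r \<le> 1" "r < c + 2 * l + 1" using r0 ln1 by (auto simp: r_def b_def)
    have 1: "\<bar>gegen_moment l c n M\<bar> * r ^ M / fact M \<le> (\<Sum>m\<le>M. \<bar>gegen_moment l c n m\<bar> * r ^ m / fact m)"
      using r by (intro member_le_sum) auto
    have 2: "(\<Sum>m\<le>M. \<bar>gegen_moment l c n m\<bar> * r ^ m / fact m)
        \<le> K * (\<Prod>k<n. (\<bar>real k - c\<bar> + r) / (real k + b - r))"
      unfolding K_def b_def by (rule gegen_moment_sum_bound[OF l c r])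
    have 3: "K * (\<Prod>k<n. (\<bar>real k - c\<bar> + r) / (real k + b - r))
        \<le> K * (C * real n powr (- (c + b)) * (if c \<in> \<nat> then 1 / ln n else 1))"
      using mult_left_mono[OF C[OF n] K] unfolding r_def .
    have "\<bar>gegen_moment l c n M\<bar> * (r ^ M / fact M)
        \<le> K * C * real n powr (- (c + b)) * (if c \<in> \<nat> then 1 / ln n else 1)"
      using order_trans[OF order_trans[OF 1 2] 3] unfolding times_divide_eq_right mult.assoc .
    moreover have "r ^ M / fact M > 0" using r by simp
    ultimately have "\<bar>gegen_moment l c n M\<bar>
        \<le> K * C * real n powr (- (c + b)) * (if c \<in> \<nat> then 1 / ln n else 1) / (r ^ M / fact M)"
      by (simp only: pos_le_divide_eq)
    also have "\<dots> = A * (ln n ^ M * (if c \<in> \<nat> then 1 / ln n else 1) * real n powr (- (c + b)))"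
      by (simp add: A_def r_def power_divide)
    also have "ln n ^ M * (if c \<in> \<nat> then 1 / ln n else 1) = ln n ^ (if c \<in> \<nat> then M - 1 else M)"
      using M ln1 by (cases M) auto
    also have "- (c + b) = - 2 * c - 2 * l - 1" by (simp add: b_def)
    finally show ?thesis using ln1 by (simp add: abs_mult)
  qed
  then show ?thesis
    by (intro bigoI[of _ A] eventually_sequentiallyI[of N])
qed

subsection \<open>Functions that are flat at the endpoint\<close>

text \<open>\<open>F\<close> is \<open>j\<close> times continuously differentiable on \<open>(-1, 1)\<close>, and its \<open>i\<close>-th derivative is
  \<open>O((1 - x) powr (s - i))\<close> for \<open>i \<le> j\<close>.\<close>
fun flat_at_1 :: "nat \<Rightarrow> real \<Rightarrow> (real \<Rightarrow> real) \<Rightarrow> bool" where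
  "flat_at_1 0 s F \<longleftrightarrow> continuous_on {-1<..<1} F \<and>
     (\<exists>C. \<forall>x. -1 < x \<longrightarrow> x < 1 \<longrightarrow> \<bar>F x\<bar> \<le> C * (1 - x) powr s)"
| "flat_at_1 (Suc j) s F \<longleftrightarrow>
     (\<exists>C. \<forall>x. -1 < x \<longrightarrow> x < 1 \<longrightarrow> \<bar>F x\<bar> \<le> C * (1 - x) powr s) \<and>
     (\<exists>F'. (\<forall>x. -1 < x \<longrightarrow> x < 1 \<longrightarrow> (F has_real_derivative F' x) (at x)) \<and> flat_at_1 j (s - 1) F')"

lemma flat_at_1_bound:
  assumes "flat_at_1 j s F"
  shows "\<exists>C\<ge>0. \<forall>x. -1 < x \<longrightarrow> x < 1 \<longrightarrow> \<bar>F x\<bar> \<le> C * (1 - x) powr s"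
proof -
  obtain C where C: "\<And>x. -1 < x \<Longrightarrow> x < 1 \<Longrightarrow> \<bar>F x\<bar> \<le> C * (1 - x) powr s"
    using assms by (cases j) auto
  have "\<bar>F x\<bar> \<le> \<bar>C\<bar> * (1 - x) powr s" if "-1 < x" "x < 1" for x
    using C[OF that] mult_right_mono[OF abs_ge_self[of C] powr_ge_zero[of "1 - x" s]] by linarith
  then show ?thesis by (intro exI[of _ "\<bar>C\<bar>"]) auto
qed

lemma flat_at_1_continuous: "flat_at_1 j s F \<Longrightarrow> continuous_on {-1<..<1} F"
proof (cases j)
  case (Suc i)
  assume "flat_at_1 j s F"
  then obtain F' where "\<And>x. -1 < x \<Longrightarrow> x < 1 \<Longrightarrow> (F has_real_derivative F' x) (at x)"
    unfolding Suc by auto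
  then show ?thesis
    by (intro continuous_at_imp_continuous_on ballI) (auto intro: DERIV_isCont)
qed simp

lemma flat_at_1_SucI:
  assumes "\<And>x. -1 < x \<Longrightarrow> x < 1 \<Longrightarrow> (F has_real_derivative F' x) (at x)"
    and "flat_at_1 j (s - 1) F'"
    and "\<And>x. -1 < x \<Longrightarrow> x < 1 \<Longrightarrow> \<bar>F x\<bar> \<le> C * (1 - x) powr s"
  shows "flat_at_1 (Suc j) s F"
  using assms by auto

lemma flat_at_1_SucE:
  assumes "flat_at_1 (Suc j) s F"
  obtains F' where "\<And>x. -1 < x \<Longrightarrow> x < 1 \<Longrightarrow> (F has_real_derivative F' x) (at x)"
    and "flat_at_1 j (s - 1) F'"
  using assms by auto

lemma flat_at_1_SucD: "flat_at_1 (Suc j) s F \<Longrightarrow> flat_at_1 j s F"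
proof (induction j arbitrary: s F)
  case 0
  then show ?case using flat_at_1_continuous[OF 0] by auto
next
  case (Suc j)
  obtain F' where F': "\<And>x. -1 < x \<Longrightarrow> x < 1 \<Longrightarrow> (F has_real_derivative F' x) (at x)"
    "flat_at_1 (Suc j) (s - 1) F'"
    using flat_at_1_SucE[OF Suc.prems] by metis
  obtain C where "\<And>x. -1 < x \<Longrightarrow> x < 1 \<Longrightarrow> \<bar>F x\<bar> \<le> C * (1 - x) powr s"
    using flat_at_1_bound[OF Suc.prems] by metis
  with F'(1) Suc.IH[OF F'(2)] show ?case by (rule flat_at_1_SucI)
qed

lemma flat_at_1_le:
  assumes "i \<le> j"
  shows "flat_at_1 j s F \<Longrightarrow> flat_at_1 i s F"
  using assms by (induction j rule: dec_induct) (use flat_at_1_SucD in blast)+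

lemma flat_at_1_mono: "t \<le> s \<Longrightarrow> flat_at_1 j s F \<Longrightarrow> flat_at_1 j t F"
proof (induction j arbitrary: t s F)
  have *: "\<exists>C. \<forall>x. -1 < x \<longrightarrow> x < 1 \<longrightarrow> \<bar>F x\<bar> \<le> C * (1 - x) powr t"
    if fg: "t \<le> s" "flat_at_1 j s F" for j s t F
  proof -
    obtain C where C: "C \<ge> 0" "\<And>x. -1 < x \<Longrightarrow> x < 1 \<Longrightarrow> \<bar>F x\<bar> \<le> C * (1 - x) powr s"
      using flat_at_1_bound[OF fg(2)] by metis
    have "\<bar>F x\<bar> \<le> (C * 2 powr (s - t)) * (1 - x) powr t" if x: "-1 < x" "x < 1" for x
    proof -
      have "(1 - x) powr s = (1 - x) powr (s - t) * (1 - x) powr t"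
        by (simp add: powr_add[symmetric])
      also have "\<dots> \<le> 2 powr (s - t) * (1 - x) powr t"
        using x \<open>t \<le> s\<close> by (intro mult_right_mono powr_mono2) auto
      finally have "C * (1 - x) powr s \<le> C * (2 powr (s - t) * (1 - x) powr t)"
        using C(1) by (rule mult_left_mono)
      then show ?thesis using C(2)[OF x] by (simp add: mult.assoc)
    qed
    then show ?thesis by blast
  qed
  {
    case 0
    show ?case using *[OF 0] flat_at_1_continuous[OF 0(2)] by simp
  next
    case (Suc j)
    obtain F' where "\<And>x. -1 < x \<Longrightarrow> x < 1 \<Longrightarrow> (F has_real_derivative F' x) (at x)"
      "flat_at_1 j (s - 1) F'"
      using flat_at_1_SucE[OF Suc.prems(2)] by metis
    with Suc.IH[of "t - 1" "s - 1" F'] *[OF Suc.prems] Suc.prems show ?case by auto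
  }
qed

lemma flat_at_1_zero: "flat_at_1 j s (\<lambda>x. 0)"
proof (induction j arbitrary: s)
  case 0
  show ?case by (auto intro!: exI[of _ 0])
next
  case (Suc j)
  show ?case by (rule flat_at_1_SucI[where F' = "\<lambda>x. 0" and C = 0]) (use Suc in auto)
qed

lemma flat_at_1_const: "flat_at_1 j 0 (\<lambda>x. c)"
proof (cases j)
  case 0
  then show ?thesis by (auto intro!: exI[of _ "\<bar>c\<bar>"])
next
  case (Suc i)
  show ?thesis unfolding Suc
    by (rule flat_at_1_SucI[where F' = "\<lambda>x. 0" and C = "\<bar>c\<bar>"]) (use flat_at_1_zero in auto)
qed

lemma flat_at_1_ident: "flat_at_1 j 0 (\<lambda>x. x)"
proof (cases j)
  case 0
  then show ?thesis by (auto intro!: exI[of _ 1])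
next
  case (Suc i)
  show ?thesis unfolding Suc
    by (rule flat_at_1_SucI[where F' = "\<lambda>x. 1" and C = 1])
       (use flat_at_1_mono[OF _ flat_at_1_const] in auto)
qed

lemma flat_at_1_add: "flat_at_1 j s F \<Longrightarrow> flat_at_1 j s G \<Longrightarrow> flat_at_1 j s (\<lambda>x. F x + G x)"
proof (induction j arbitrary: s F G)
  have *: "\<exists>C. \<forall>x. -1 < x \<longrightarrow> x < 1 \<longrightarrow> \<bar>F x + G x\<bar> \<le> C * (1 - x) powr s"
    if fg: "flat_at_1 j s F" "flat_at_1 j s G" for j s F G
  proof -
    obtain C D where "\<And>x. -1 < x \<Longrightarrow> x < 1 \<Longrightarrow> \<bar>F x\<bar> \<le> C * (1 - x) powr s"
      "\<And>x. -1 < x \<Longrightarrow> x < 1 \<Longrightarrow> \<bar>G x\<bar> \<le> D * (1 - x) powr s"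
      using flat_at_1_bound[OF fg(1)] flat_at_1_bound[OF fg(2)] by metis
    then have "\<bar>F x + G x\<bar> \<le> (C + D) * (1 - x) powr s" if "-1 < x" "x < 1" for x
      using that by (smt (verit) distrib_right)
    then show ?thesis by blast
  qed
  {
    case 0
    then show ?case using *[OF 0] by (simp add: continuous_on_add)
  next
    case (Suc j)
    obtain F' where F': "\<And>x. -1 < x \<Longrightarrow> x < 1 \<Longrightarrow> (F has_real_derivative F' x) (at x)"
      "flat_at_1 j (s - 1) F'"
      using flat_at_1_SucE[OF Suc.prems(1)] by metis
    obtain G' where G': "\<And>x. -1 < x \<Longrightarrow> x < 1 \<Longrightarrow> (G has_real_derivative G' x) (at x)"
      "flat_at_1 j (s - 1) G'"
      using flat_at_1_SucE[OF Suc.prems(2)] by metis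
    have "flat_at_1 j (s - 1) (\<lambda>x. F' x + G' x)" by (rule Suc.IH[OF F'(2) G'(2)])
    moreover have "((\<lambda>x. F x + G x) has_real_derivative F' x + G' x) (at x)" if "-1 < x" "x < 1" for x
      using F'(1)[OF that] G'(1)[OF that] by (rule DERIV_add)
    moreover obtain C where "\<forall>x. -1 < x \<longrightarrow> x < 1 \<longrightarrow> \<bar>F x + G x\<bar> \<le> C * (1 - x) powr s"
      using *[OF Suc.prems] by blast
    ultimately show ?case by (intro flat_at_1_SucI) auto
  }
qed

lemma flat_at_1_mult:
  "flat_at_1 j s F \<Longrightarrow> flat_at_1 j t G \<Longrightarrow> flat_at_1 j (s + t) (\<lambda>x. F x * G x)"
proof (induction j arbitrary: s t F G)
  have *: "\<exists>C. \<forall>x. -1 < x \<longrightarrow> x < 1 \<longrightarrow> \<bar>F x * G x\<bar> \<le> C * (1 - x) powr (s + t)"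
    if fg: "flat_at_1 j s F" "flat_at_1 j t G" for j s t F G
  proof -
    obtain C D where C: "C \<ge> 0" "\<And>x. -1 < x \<Longrightarrow> x < 1 \<Longrightarrow> \<bar>F x\<bar> \<le> C * (1 - x) powr s"
      and D: "\<And>x. -1 < x \<Longrightarrow> x < 1 \<Longrightarrow> \<bar>G x\<bar> \<le> D * (1 - x) powr t"
      using flat_at_1_bound[OF fg(1)] flat_at_1_bound[OF fg(2)] by metis
    have "\<bar>F x * G x\<bar> \<le> (C * D) * (1 - x) powr (s + t)" if x: "-1 < x" "x < 1" for x
    proof -
      have "\<bar>F x * G x\<bar> \<le> (C * (1 - x) powr s) * (D * (1 - x) powr t)"
        unfolding abs_mult using C D x by (intro mult_mono) auto
      then show ?thesis by (simp add: powr_add mult_ac)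
    qed
    then show ?thesis by blast
  qed
  {
    case 0
    then show ?case using *[OF 0] by (simp add: continuous_on_mult)
  next
    case (Suc j)
    obtain F' where F': "\<And>x. -1 < x \<Longrightarrow> x < 1 \<Longrightarrow> (F has_real_derivative F' x) (at x)"
      "flat_at_1 j (s - 1) F'"
      using flat_at_1_SucE[OF Suc.prems(1)] by metis
    obtain G' where G': "\<And>x. -1 < x \<Longrightarrow> x < 1 \<Longrightarrow> (G has_real_derivative G' x) (at x)"
      "flat_at_1 j (t - 1) G'"
      using flat_at_1_SucE[OF Suc.prems(2)] by metis
    have "flat_at_1 j (s - 1 + t) (\<lambda>x. F' x * G x)" "flat_at_1 j (t - 1 + s) (\<lambda>x. G' x * F x)"
      using Suc.IH[OF F'(2) flat_at_1_SucD[OF Suc.prems(2)]]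
        Suc.IH[OF G'(2) flat_at_1_SucD[OF Suc.prems(1)]] by auto
    then have "flat_at_1 j (s + t - 1) (\<lambda>x. F' x * G x + G' x * F x)"
      by (intro flat_at_1_add) (simp_all add: algebra_simps)
    moreover have "((\<lambda>x. F x * G x) has_real_derivative F' x * G x + G' x * F x) (at x)" if "-1 < x" "x < 1" for x
      using F'(1)[OF that] G'(1)[OF that] by (rule DERIV_mult)
    moreover obtain C where "\<forall>x. -1 < x \<longrightarrow> x < 1 \<longrightarrow> \<bar>F x * G x\<bar> \<le> C * (1 - x) powr (s + t)"
      using *[OF Suc.prems] by blast
    ultimately show ?case by (intro flat_at_1_SucI) auto
  }
qed

lemma flat_at_1_cmult: "flat_at_1 j s F \<Longrightarrow> flat_at_1 j s (\<lambda>x. c * F x)"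
  using flat_at_1_mult[OF flat_at_1_const, of j s F c] by simp

lemma flat_at_1_powr: "flat_at_1 j s (\<lambda>x. (1 - x) powr s)"
proof (induction j arbitrary: s)
  case 0
  show ?case by (auto intro!: exI[of _ 1] continuous_intros)
next
  case (Suc j)
  show ?case
  proof (rule flat_at_1_SucI[where C = 1])
    show "flat_at_1 j (s - 1) (\<lambda>x. (- s) * (1 - x) powr (s - 1))"
      by (intro flat_at_1_cmult Suc)
    show "((\<lambda>x. (1 - x) powr s) has_real_derivative (- s) * (1 - x) powr (s - 1)) (at x)" if "x < 1" for x
      using that by (auto intro!: derivative_eq_intros)
  qed simp
qed

text \<open>The exponent -1 is deliberately crude: a full power of 1 - x is given away for each
  logarithm, and further Taylor terms of \<open>g\<close> make up for it later.\<close>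

lemma flat_at_1_ln: "flat_at_1 j (-1) (\<lambda>x. ln (1 - x))"
proof -
  obtain C where C: "\<And>y::real. 0 < y \<Longrightarrow> y < 2 \<Longrightarrow> \<bar>ln y\<bar> ^ 1 \<le> C * y powr (- 1)"
    using abs_ln_power_bound[of 1 1] by auto
  have b: "\<bar>ln (1 - x)\<bar> \<le> C * (1 - x) powr (-1)" if "-1 < x" "x < 1" for x
    using C[of "1 - x"] that by simp
  show ?thesis
  proof (cases j)
    case 0
    then show ?thesis using b by (auto intro!: continuous_intros)
  next
    case (Suc i)
    show ?thesis unfolding Suc
    proof (rule flat_at_1_SucI)
      show "flat_at_1 i (- 1 - 1) (\<lambda>x. (-1) * (1 - x) powr (- 1))"
        by (rule flat_at_1_mono[OF _ flat_at_1_cmult[OF flat_at_1_powr]]) simp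
      show "((\<lambda>x. ln (1 - x)) has_real_derivative (-1) * (1 - x) powr (- 1)) (at x)" if "x < 1" for x
        using that by (auto intro!: derivative_eq_intros simp: powr_minus divide_inverse)
    qed (use b in auto)
  qed
qed

lemma flat_at_1_ln_power: "flat_at_1 j (- real m) (\<lambda>x. ln (1 - x) ^ m)"
proof (induction m)
  case (Suc m)
  have "flat_at_1 j (- 1 + - real m) (\<lambda>x. ln (1 - x) * ln (1 - x) ^ m)"
    by (rule flat_at_1_mult[OF flat_at_1_ln Suc])
  moreover have "- 1 + - real m = - real (Suc m)" by simp
  ultimately show ?case by (simp only: power_Suc)
qed (use flat_at_1_const in simp)

text \<open>The induction hypothesis is applied to the derivative of \<open>g\<close>, so flatness
  of all derivatives of the remainder comes along. Termwise integration fixes every coefficient but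
  the constant one, which is taken as \<open>g 1\<close> to make the remainder vanish at 1. The mean
  value theorem on [x, 1] then gains one power of 1 - x.\<close>

lemma smooth_taylor_flat_at_1:
  assumes "smooth_on_interval {-1..1} g"
  shows "\<exists>a. flat_at_1 K (real K) (\<lambda>x. g x - (\<Sum>k<K. a k * (1 - x) ^ k))"
  using assms
proof (induction K arbitrary: g)
  case 0
  then have "continuous_on {-1..1} g"
    unfolding smooth_on_interval_def continuous_on_eq_continuous_within
    by (metis DERIV_continuous)
  then have "compact (g ` {-1..1})" and "continuous_on {-1<..<1} g"
    by (auto intro: compact_continuous_image continuous_on_subset)
  then obtain B where "\<forall>y\<in>g ` {-1..1}. norm y \<le> B" using compact_imp_bounded bounded_iff by metis
  with \<open>continuous_on {-1<..<1} g\<close> show ?case by (auto intro!: exI[of _ B])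
next
  case (Suc K)
  then obtain G where G: "G 0 = g"
    "\<And>k x. x \<in> {-1..1} \<Longrightarrow> (G k has_real_derivative G (Suc k) x) (at x within {-1..1})"
    unfolding smooth_on_interval_def by blast
  have "smooth_on_interval {-1..1} (G 1)"
    unfolding smooth_on_interval_def using G by (intro exI[of _ "\<lambda>k. G (Suc k)"]) auto
  then obtain a where a: "flat_at_1 K (real K) (\<lambda>x. G 1 x - (\<Sum>k<K. a k * (1 - x) ^ k))"
    using Suc.IH by blast
  \<comment> \<open>The coefficients integrate the expansion of the derivative in powers of 1 - x;
    the inner derivative -1 accounts for the minus sign.\<close>
  define a' where "a' = (\<lambda>k. case k of 0 \<Rightarrow> g 1 | Suc i \<Rightarrow> - a i / real (Suc i))"
  define R where "R = (\<lambda>x. g x - (\<Sum>k<Suc K. a' k * (1 - x) ^ k))"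
  define R' where "R' = (\<lambda>x. G 1 x - (\<Sum>k<K. a k * (1 - x) ^ k))"
  have Req: "R = (\<lambda>x. g x - (g 1 + (\<Sum>k<K. (- a k / real (Suc k)) * (1 - x) ^ Suc k)))"
    unfolding R_def by (simp add: sum.lessThan_Suc_shift a'_def del: sum.lessThan_Suc)
  have dR: "(R has_real_derivative R' x) (at x within {-1..1})" if x: "x \<in> {-1..1}" for x
  proof -
    have "((\<lambda>x. (- a k / real (Suc k)) * (1 - x) ^ Suc k) has_real_derivative a k * (1 - x) ^ k) (at x within {-1..1})" for k
      by (auto intro!: derivative_eq_intros simp del: power_Suc of_nat_Suc)
    then have "((\<lambda>x. g 1 + (\<Sum>k<K. (- a k / real (Suc k)) * (1 - x) ^ Suc k)) has_real_derivative
        0 + (\<Sum>k<K. a k * (1 - x) ^ k)) (at x within {-1..1})"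
      by (intro DERIV_add DERIV_const DERIV_sum)
    moreover have "(g has_real_derivative G 1 x) (at x within {-1..1})"
      using G(2)[of x 0] x G(1) by simp
    ultimately show ?thesis unfolding Req R'_def using DERIV_diff by fastforce
  qed
  have dR': "(R has_real_derivative R' x) (at x)" if "-1 < x" "x < 1" for x
    using dR[of x] that by (simp add: at_within_Icc_at)
  have contR: "continuous_on {-1..1} R"
    unfolding continuous_on_eq_continuous_within using dR DERIV_continuous by blast
  have R1: "R 1 = 0" by (simp add: Req)
  have R': "flat_at_1 K (real K) R'" using a unfolding R'_def .
  obtain C where C: "C \<ge> 0" "\<And>x. -1 < x \<Longrightarrow> x < 1 \<Longrightarrow> \<bar>R' x\<bar> \<le> C * (1 - x) powr real K"
    using flat_at_1_bound[OF R'] by blast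
  have "flat_at_1 (Suc K) (real (Suc K)) R"
  proof (rule flat_at_1_SucI[where C = C])
    show "flat_at_1 K (real (Suc K) - 1) R'" using R' by simp
    fix x :: real assume x: "-1 < x" "x < 1"
    show "(R has_real_derivative R' x) (at x)" by (rule dR'[OF x])
    have "continuous_on {x..1} R" by (rule continuous_on_subset[OF contR]) (use x in auto)
    moreover have "R differentiable (at z)" if "x < z" "z < 1" for z
      using dR'[of z] that x real_differentiable_def by force
    ultimately obtain d z where z: "x < z" "z < 1" "(R has_real_derivative d) (at z)" "R 1 - R x = (1 - x) * d"
      using MVT[of x 1 R] x by blast
    then have "d = R' z" using dR'[of z] x DERIV_unique by auto
    then have "\<bar>R x\<bar> = (1 - x) * \<bar>R' z\<bar>" using z(4) R1 x by (simp add: abs_mult flip: abs_minus_cancel[of "R x"])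
    also have "\<dots> \<le> (1 - x) * (C * (1 - x) powr real K)"
    proof (rule mult_left_mono)
      have "\<bar>R' z\<bar> \<le> C * (1 - z) powr real K" using C(2) z x by simp
      also have "\<dots> \<le> C * (1 - x) powr real K" using C(1) z x by (intro mult_left_mono powr_mono2) auto
      finally show "\<bar>R' z\<bar> \<le> C * (1 - x) powr real K" .
    qed (use x in simp)
    also have "\<dots> = C * (1 - x) powr real (Suc K)" using x by (simp add: powr_add)
    finally show "\<bar>R x\<bar> \<le> C * (1 - x) powr real (Suc K)" .
  qed
  then show ?case unfolding R_def by blast
qed

subsection \<open>The Gegenbauer operator and the norms\<close>

text \<open>This is Lagrange's identity: with P the polynomial of degree n, the derivative of (1 -
  x^2) powr (l + 1/2) * (P F' - P' F) equals, by the differential equation for P, the difference of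
  the two integrands. The boundary terms vanish because \<open>l + 1/2\<close> is positive and the
  other factor is bounded.\<close>

lemma gegen_self_adjoint:
  assumes l: "l > -1/2"
    and F1: "\<And>x. -1 < x \<Longrightarrow> x < 1 \<Longrightarrow> (F has_real_derivative F1 x) (at x)"
    and F2: "\<And>x. -1 < x \<Longrightarrow> x < 1 \<Longrightarrow> (F1 has_real_derivative F2 x) (at x)"
    and cont: "continuous_on {-1<..<1} F2"
    and bound: "\<And>x. -1 < x \<Longrightarrow> x < 1 \<Longrightarrow> \<bar>F x\<bar> \<le> C"
      "\<And>x. -1 < x \<Longrightarrow> x < 1 \<Longrightarrow> \<bar>F1 x\<bar> \<le> C"
      "\<And>x. -1 < x \<Longrightarrow> x < 1 \<Longrightarrow> \<bar>F2 x\<bar> \<le> C"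
  shows "real n * (real n + 2 * l) * (LBINT x:{-1<..<1}. gweight l x * (poly (gegen l n) x * F x))
    = (LBINT x:{-1<..<1}. gweight l x * (poly (gegen l n) x * ((2 * l + 1) * x * F1 x - (1 - x\<^sup>2) * F2 x)))"
proof -
  define P P1 P2 where "P = poly (gegen l n)" and "P1 = poly (pderiv (gegen l n))"
    and "P2 = poly (pderiv (pderiv (gegen l n)))"
  have contF: "continuous_on {-1<..<1} F"
    by (intro continuous_at_imp_continuous_on ballI DERIV_isCont[OF F1]) auto
  have contF1: "continuous_on {-1<..<1} F1"
    by (intro continuous_at_imp_continuous_on ballI DERIV_isCont[OF F2]) auto
  have contP: "continuous_on {-1<..<1} P"
    unfolding P_def by (intro continuous_intros)
  obtain B where B: "B \<ge> 0" "\<And>x. -1 < x \<Longrightarrow> x < 1 \<Longrightarrow> \<bar>P x\<bar> \<le> B"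
    using poly_bounded_unit unfolding P_def by blast
  obtain B1 where B1: "B1 \<ge> 0" "\<And>x. -1 < x \<Longrightarrow> x < 1 \<Longrightarrow> \<bar>P1 x\<bar> \<le> B1"
    using poly_bounded_unit unfolding P1_def by blast
  define LF where "LF = (\<lambda>x. (2 * l + 1) * x * F1 x - (1 - x\<^sup>2) * F2 x)"
  have LF: "\<bar>LF x\<bar> \<le> (2 * l + 1) * C + C" if x: "-1 < x" "x < 1" for x
  proof -
    have "\<bar>LF x\<bar> \<le> \<bar>(2 * l + 1) * x * F1 x\<bar> + \<bar>(1 - x\<^sup>2) * F2 x\<bar>"
      unfolding LF_def by (rule abs_triangle_ineq4)
    also have "\<bar>(2 * l + 1) * x * F1 x\<bar> \<le> (2 * l + 1) * 1 * C"
      unfolding abs_mult using l x bound by (intro mult_mono) auto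
    also have "\<bar>(1 - x\<^sup>2) * F2 x\<bar> \<le> 1 * C"
      unfolding abs_mult using one_minus_square_pos[OF x] bound x by (intro mult_mono) auto
    finally show ?thesis by simp
  qed
  have contLF: "continuous_on {-1<..<1} LF"
    unfolding LF_def by (intro continuous_intros contF1 cont)
  have i1: "set_integrable lborel {-1<..<1} (\<lambda>x. gweight l x * (P x * F x))"
  proof (rule integrable_gweight_bounded[OF l])
    show "\<bar>P x * F x\<bar> \<le> B * C" if "-1 < x" "x < 1" for x
      unfolding abs_mult using B bound that by (intro mult_mono) auto
  qed (intro continuous_intros contF contP)
  have i2: "set_integrable lborel {-1<..<1} (\<lambda>x. gweight l x * (P x * LF x))"
  proof (rule integrable_gweight_bounded[OF l])
    show "\<bar>P x * LF x\<bar> \<le> B * ((2 * l + 1) * C + C)" if "-1 < x" "x < 1" for x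
      unfolding abs_mult using B LF that by (intro mult_mono) auto
  qed (intro continuous_intros contLF contP)
  define N where "N = real n * (real n + 2 * l)"
  define G where "G = (\<lambda>x. (1 - x\<^sup>2) powr (l + 1/2) * (P x * F1 x - P1 x * F x))"
  define G' where "G' = (\<lambda>x. N * (gweight l x * (P x * F x)) - gweight l x * (P x * LF x))"
  have "(LBINT x:{-1<..<1}. G' x) = 0"
  proof (rule integral_deriv_eq_0[where G = G and C = "B * C + B1 * C" and p = "l + 1/2" and q = "l + 1/2"])
    show "continuous_on {-1<..<1} G'"
      unfolding G'_def by (intro continuous_intros contF contLF contP continuous_on_gweight)
    show "set_integrable lborel {-1<..<1} G'"
      unfolding G'_def by (intro set_integral_diff set_integrable_mult_right i1 i2)
    show "l + 1/2 > 0" "l + 1/2 > 0" using l by auto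
    fix x :: real assume x: "-1 < x" "x < 1"
    have "\<bar>P x * F1 x - P1 x * F x\<bar> \<le> \<bar>P x * F1 x\<bar> + \<bar>P1 x * F x\<bar>" by (rule abs_triangle_ineq4)
    also have "\<bar>P x * F1 x\<bar> \<le> B * C"
      unfolding abs_mult using B bound x by (intro mult_mono) auto
    also have "\<bar>P1 x * F x\<bar> \<le> B1 * C"
      unfolding abs_mult using B1 bound x by (intro mult_mono) auto
    finally have "(1 - x\<^sup>2) powr (l + 1/2) * \<bar>P x * F1 x - P1 x * F x\<bar> \<le> (1 - x\<^sup>2) powr (l + 1/2) * (B * C + B1 * C)"
      by (intro mult_left_mono) auto
    then show "\<bar>G x\<bar> \<le> (B * C + B1 * C) * (1 - x) powr (l + 1/2) * (1 + x) powr (l + 1/2)"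
      unfolding G_def abs_mult by (simp add: powr_one_minus_square[OF x] mult_ac)
    have w: "(1 - x\<^sup>2) powr (l + 1/2) = gweight l x * (1 - x\<^sup>2)"
      using one_minus_square_pos[OF x] powr_add[of "1 - x\<^sup>2" "l - 1/2" 1] by (simp add: gweight_def add.commute)
    have "((\<lambda>x. (1 - x\<^sup>2) powr (l + 1/2)) has_real_derivative (l + 1/2) * gweight l x * (- 2 * x)) (at x)"
      using one_minus_square_pos[OF x] unfolding gweight_def
      by (auto intro!: derivative_eq_intros)
    moreover have "((\<lambda>x. P x * F1 x - P1 x * F x) has_real_derivative
        (P1 x * F1 x + F2 x * P x) - (P2 x * F x + F1 x * P1 x)) (at x)"
      unfolding P_def P1_def P2_def
      by (intro DERIV_diff DERIV_mult poly_DERIV F1 F2 x)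
    ultimately have "(G has_real_derivative
        (l + 1/2) * gweight l x * (- 2 * x) * (P x * F1 x - P1 x * F x)
        + ((P1 x * F1 x + F2 x * P x) - (P2 x * F x + F1 x * P1 x)) * (1 - x\<^sup>2) powr (l + 1/2)) (at x)"
      unfolding G_def by (rule DERIV_mult)
    moreover have "(l + 1/2) * gweight l x * (- 2 * x) * (P x * F1 x - P1 x * F x)
        + ((P1 x * F1 x + F2 x * P x) - (P2 x * F x + F1 x * P1 x)) * (1 - x\<^sup>2) powr (l + 1/2) = G' x"
    proof -
      have ode: "N * P x = (2 * l + 1) * x * P1 x - (1 - x\<^sup>2) * P2 x"
        using gegen_ode[OF l, of x n] unfolding N_def P_def P1_def P2_def by linarith
      have "G' x = gweight l x * ((N * P x) * F x - P x * LF x)"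
        unfolding G'_def by (simp add: algebra_simps)
      then show ?thesis unfolding w ode LF_def by (simp add: field_simps)
    qed
    ultimately show "(G has_real_derivative G' x) (at x)" by simp
  qed
  then show ?thesis
    using i1 i2 unfolding G'_def P_def LF_def N_def
    by (subst (asm) set_integral_diff) auto
qed

section \<open>Orthogonality and size of the norms\<close>

definition gegen_int :: "real \<Rightarrow> real poly \<Rightarrow> real" where
  "gegen_int l p = (LBINT x:{-1<..<1}. gweight l x * poly p x)"

lemma gegen_int_add: "l > -1/2 \<Longrightarrow> gegen_int l (p + q) = gegen_int l p + gegen_int l q"
  unfolding gegen_int_def using integrable_gweight_poly
  by (simp add: distrib_left set_integral_add)

lemma gegen_int_diff: "l > -1/2 \<Longrightarrow> gegen_int l (p - q) = gegen_int l p - gegen_int l q"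
  unfolding gegen_int_def using integrable_gweight_poly
  by (simp add: right_diff_distrib set_integral_diff)

lemma gegen_int_smult: "gegen_int l (smult c p) = c * gegen_int l p"
  unfolding gegen_int_def by (simp add: mult.left_commute)

text \<open>Both polynomials are eigenfunctions of the self-adjoint operator. The eigenvalues differ
  by (n - m) (n + m + 2 l), which is nonzero because n + m >= 1 and 2 l > -1.\<close>

lemma gegen_orthogonal:
  assumes l: "l > -1/2" and "m \<noteq> n"
  shows "gegen_int l (gegen l n * gegen l m) = 0"
proof -
  obtain B0 where B0: "B0 \<ge> 0" "\<And>x. -1 < x \<Longrightarrow> x < 1 \<Longrightarrow> \<bar>poly (gegen l m) x\<bar> \<le> B0"
    using poly_bounded_unit by blast
  obtain B1 where B1: "B1 \<ge> 0" "\<And>x. -1 < x \<Longrightarrow> x < 1 \<Longrightarrow> \<bar>poly (pderiv (gegen l m)) x\<bar> \<le> B1"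
    using poly_bounded_unit by blast
  obtain B2 where B2: "B2 \<ge> 0" "\<And>x. -1 < x \<Longrightarrow> x < 1 \<Longrightarrow> \<bar>poly (pderiv (pderiv (gegen l m))) x\<bar> \<le> B2"
    using poly_bounded_unit by blast
  have ode: "(2 * l + 1) * x * poly (pderiv (gegen l m)) x - (1 - x\<^sup>2) * poly (pderiv (pderiv (gegen l m))) x
    = real m * (real m + 2 * l) * poly (gegen l m) x" for x
    using gegen_ode[OF l, of x m] by linarith
  have "real n * (real n + 2 * l) * (LBINT x:{-1<..<1}. gweight l x * (poly (gegen l n) x * poly (gegen l m) x))
    = (LBINT x:{-1<..<1}. gweight l x * (poly (gegen l n) x *
        ((2 * l + 1) * x * poly (pderiv (gegen l m)) x - (1 - x\<^sup>2) * poly (pderiv (pderiv (gegen l m))) x)))"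
  proof (rule gegen_self_adjoint[OF l, where C = "B0 + B1 + B2"])
    fix x :: real assume x: "-1 < x" "x < 1"
    show "\<bar>poly (gegen l m) x\<bar> \<le> B0 + B1 + B2" "\<bar>poly (pderiv (gegen l m)) x\<bar> \<le> B0 + B1 + B2"
      "\<bar>poly (pderiv (pderiv (gegen l m))) x\<bar> \<le> B0 + B1 + B2"
      using B0(1) B0(2)[OF x] B1(1) B1(2)[OF x] B2(1) B2(2)[OF x] by linarith+
  qed (auto intro: poly_DERIV continuous_intros)
  also have "\<dots> = (LBINT x:{-1<..<1}. real m * (real m + 2 * l) * (gweight l x * (poly (gegen l n) x * poly (gegen l m) x)))"
    unfolding ode by (simp add: mult_ac)
  finally have "(real n * (real n + 2 * l) - real m * (real m + 2 * l)) * gegen_int l (gegen l n * gegen l m) = 0"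
    unfolding gegen_int_def poly_mult by (simp only: set_integral_mult_right left_diff_distrib)
  moreover have "real n * (real n + 2 * l) - real m * (real m + 2 * l) = (real n - real m) * (real n + real m + 2 * l)"
    by (simp add: algebra_simps)
  moreover have "real n + real m + 2 * l \<noteq> 0"
  proof -
    have "real n + real m \<ge> 1" using \<open>m \<noteq> n\<close> by linarith
    then show ?thesis using l by linarith
  qed
  ultimately show ?thesis using \<open>m \<noteq> n\<close> by simp
qed

definition gegen_sqnorm :: "real \<Rightarrow> nat \<Rightarrow> real" where
  "gegen_sqnorm l n = gegen_int l (gegen l n * gegen l n)"

lemma gegen_int_rec:
  assumes l: "l > -1/2"
  shows "(real n + 1 + 2 * l) * gegen_int l (gegen l (Suc (Suc n)) * q)
    = 2 * (real n + 1 + l) * gegen_int l ([:0, 1:] * gegen l (Suc n) * q) - (real n + 1) * gegen_int l (gegen l n * q)"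
proof -
  have "smult (real n + 1 + 2 * l) (gegen l (Suc (Suc n)) * q) = smult (2 * (real n + 1 + l)) ([:0, 1:] * gegen l (Suc n) * q)
      - smult (real n + 1) (gegen l n * q)"
    (is "?L = ?R")
  proof (intro poly_eq_poly_eq_iff[THEN iffD1] ext)
    fix x
    have "poly ?L x = ((real n + 1 + 2 * l) * poly (gegen l (Suc (Suc n))) x) * poly q x"
      by (simp del: gegen.simps)
    also have "\<dots> = poly ?R x"
      unfolding gegen_rec[OF l] by (simp add: left_diff_distrib del: gegen.simps)
    finally show "poly ?L x = poly ?R x" .
  qed
  then have "gegen_int l ?L = gegen_int l ?R" by (rule arg_cong)
  then show ?thesis by (simp only: gegen_int_smult gegen_int_diff[OF l])
qed

text \<open>The recurrence for degree n + 2 paired with that same polynomial, and the one for degree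
  n + 3 paired with degree n + 1, contain the same mixed integral \<open>X\<close>. Orthogonality
  removes the other cross term from each, and eliminating \<open>X\<close> relates consecutive
  norms.\<close>

lemma gegen_sqnorm_Suc_Suc:
  assumes l: "l > -1/2"
  shows "(real n + 1 + 2 * l) * (real n + 2 + l) * gegen_sqnorm l (Suc (Suc n))
    = (real n + 1 + l) * (real n + 2) * gegen_sqnorm l (Suc n)"
proof -
  define X where "X = gegen_int l ([:0, 1:] * gegen l (Suc n) * gegen l (Suc (Suc n)))"
  have X': "X = gegen_int l ([:0, 1:] * gegen l (Suc (Suc n)) * gegen l (Suc n))"
    unfolding X_def by (simp only: mult.assoc mult.commute[of "gegen l (Suc n)"])
  have 1: "(real n + 1 + 2 * l) * gegen_sqnorm l (Suc (Suc n)) = 2 * (real n + 1 + l) * X"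
    using gegen_int_rec[OF l, of n "gegen l (Suc (Suc n))"] gegen_orthogonal[OF l, of "Suc (Suc n)" n]
    unfolding gegen_sqnorm_def X_def by simp
  have 2: "2 * (real n + 2 + l) * X = (real n + 2) * gegen_sqnorm l (Suc n)"
    using gegen_int_rec[OF l, of "Suc n" "gegen l (Suc n)"] gegen_orthogonal[OF l, of "Suc n" "Suc (Suc (Suc n))"]
    unfolding gegen_sqnorm_def X' by (simp del: gegen.simps add: algebra_simps)
  show ?thesis using 1 2 by algebra
qed

lemma gegen_sqnorm_1:
  assumes l: "l > -1/2"
  shows "2 * (1 + l) * gegen_sqnorm l 1 = gegen_sqnorm l 0"
  using gegen_int_rec[OF l, of 0 1] gegen_orthogonal[OF l, of 0 "Suc (Suc 0)"]
  unfolding gegen_sqnorm_def by (simp add: numeral_2_eq_2 del: gegen.simps(3))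

lemma gegen_sqnorm_nonneg: "gegen_sqnorm l n \<ge> 0"
  unfolding gegen_sqnorm_def gegen_int_def set_lebesgue_integral_def
  by (intro integral_nonneg_AE AE_I2) (simp add: gweight_nonneg)

text \<open>Any polynomial bound serves, since the iterated operator supplies arbitrary powers of 1
  / n. The inequality \<open>key\<close> says that the ratio of consecutive norms is at most ((t +
  1) / t)^2 with t = n. The induction starts at 2 because \<open>key\<close> fails at t = 1 for
  \<open>l\<close> close to -1/2.\<close>

lemma gegen_sqnorm_le:
  assumes l: "l > -1/2" and n: "n \<ge> 2"
  shows "gegen_sqnorm l n \<le> gegen_sqnorm l 2 * (real n)\<^sup>2"
  using n
proof (induction n rule: dec_induct)
  case base
  show ?case using gegen_sqnorm_nonneg[of l 2] by (simp add: mult_le_cancel_left1)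
next
  case (step n)
  then obtain k where k: "n = Suc k" "k \<ge> 1" by (cases n) auto
  define t where "t = real k + 1"
  have t: "t \<ge> 2" using k by (simp add: t_def)
  have rec: "(t + 2 * l) * (t + 1 + l) * gegen_sqnorm l (Suc n) = (t + l) * (t + 1) * gegen_sqnorm l n"
    using gegen_sqnorm_Suc_Suc[OF l, of k] unfolding k(1) t_def by (simp add: algebra_simps)
  have pos: "(t + 2 * l) * (t + 1 + l) > 0" using t l by (intro mult_pos_pos) auto
  have key: "(t + l) * t\<^sup>2 \<le> (t + 2 * l) * (t + 1 + l) * (t + 1)"
  proof -
    \<comment> \<open>In the shifted variables \<open>u > 0\<close> and \<open>v >= 0\<close> the
      difference of the two sides has only nonnegative coefficients.\<close>
    define u where "u = l + 1/2"
    have u: "u > 0" "l = u - 1/2" using l by (auto simp: u_def)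
    define v where "v = t - 2"
    have v: "v \<ge> 0" "t = v + 2" using t by (auto simp: v_def)
    have "(t + 2 * l) * (t + 1 + l) * (t + 1) - (t + l) * t\<^sup>2
        = v\<^sup>2 + 3 * v + 3/2 + u * (2 * v\<^sup>2 + 11 * v + 14) + 2 * u\<^sup>2 * (v + 3)"
      unfolding u(2) v(2) by (simp add: power2_eq_square field_simps)
    moreover have "\<dots> \<ge> 0" using u v by simp
    ultimately show ?thesis by linarith
  qed
  have "(t + 2 * l) * (t + 1 + l) * gegen_sqnorm l (Suc n) \<le> (t + l) * (t + 1) * (gegen_sqnorm l 2 * t\<^sup>2)"
  proof -
    have "real n = t" by (simp add: k(1) t_def)
    then have "gegen_sqnorm l n \<le> gegen_sqnorm l 2 * t\<^sup>2" using step.IH by simp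
    then show ?thesis unfolding rec using t l by (intro mult_left_mono) auto
  qed
  also have "\<dots> = (gegen_sqnorm l 2 * (t + 1)) * ((t + l) * t\<^sup>2)" by (simp add: mult_ac)
  also have "\<dots> \<le> (gegen_sqnorm l 2 * (t + 1)) * ((t + 2 * l) * (t + 1 + l) * (t + 1))"
    using gegen_sqnorm_nonneg[of l 2] t by (intro mult_left_mono key) auto
  also have "\<dots> = (t + 2 * l) * (t + 1 + l) * (gegen_sqnorm l 2 * (real (Suc n))\<^sup>2)"
    unfolding k(1) t_def by (simp add: power2_eq_square algebra_simps)
  finally show ?case using pos by (simp only: mult_le_cancel_left_pos)
qed

text \<open>The pointwise inequality |p| <= 1 + p^2 turns the absolute integral into a sum of two
  norms; \<open>gegen_sqnorm l 0\<close> is the total mass of the weight.\<close>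

lemma gegen_abs_int_le:
  assumes l: "l > -1/2" and cont: "continuous_on {-1<..<1} E"
    and bound: "\<And>x. -1 < x \<Longrightarrow> x < 1 \<Longrightarrow> \<bar>E x\<bar> \<le> C"
  shows "\<bar>LBINT x:{-1<..<1}. gweight l x * (poly (gegen l n) x * E x)\<bar>
    \<le> C * (gegen_sqnorm l 0 + gegen_sqnorm l n)"
proof -
  obtain B where B: "B \<ge> 0" "\<And>x. -1 < x \<Longrightarrow> x < 1 \<Longrightarrow> \<bar>poly (gegen l n) x\<bar> \<le> B"
    using poly_bounded_unit by blast
  have "\<bar>E 0\<bar> \<le> C" by (rule bound) auto
  then have C: "C \<ge> 0" by linarith
  have i1: "set_integrable lborel {-1<..<1} (\<lambda>x. gweight l x * (poly (gegen l n) x * E x))"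
  proof (rule integrable_gweight_bounded[OF l])
    show "\<bar>poly (gegen l n) x * E x\<bar> \<le> B * C" if "-1 < x" "x < 1" for x
      unfolding abs_mult using B bound that by (intro mult_mono) auto
  qed (intro continuous_intros cont)
  have i2: "set_integrable lborel {-1<..<1} (\<lambda>x. gweight l x * poly (smult C (gegen l 0 * gegen l 0 + gegen l n * gegen l n)) x)"
    by (rule integrable_gweight_poly[OF l])
  have "\<bar>LBINT x:{-1<..<1}. gweight l x * (poly (gegen l n) x * E x)\<bar>
     \<le> (LBINT x:{-1<..<1}. \<bar>gweight l x * (poly (gegen l n) x * E x)\<bar>)"
    using set_integral_norm_bound[OF i1] by simp
  also have "\<dots> \<le> (LBINT x:{-1<..<1}. gweight l x * poly (smult C (gegen l 0 * gegen l 0 + gegen l n * gegen l n)) x)"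
  proof (rule set_integral_mono[OF set_integrable_abs[OF i1] i2])
    fix x :: real assume "x \<in> {-1<..<1}"
    then have x: "-1 < x" "x < 1" by auto
    define p where "p = poly (gegen l n) x"
    have "\<bar>p\<bar> \<le> 1 + p * p" using zero_le_power2[of "\<bar>p\<bar> - 1"] by (simp add: power2_eq_square algebra_simps)
    then have "\<bar>p\<bar> * \<bar>E x\<bar> \<le> (1 + p * p) * C" using bound[OF x] by (intro mult_mono) auto
    then have "gweight l x * (\<bar>p\<bar> * \<bar>E x\<bar>) \<le> gweight l x * ((1 + p * p) * C)"
      by (intro mult_left_mono gweight_nonneg)
    then show "\<bar>gweight l x * (poly (gegen l n) x * E x)\<bar> \<le> gweight l x * poly (smult C (gegen l 0 * gegen l 0 + gegen l n * gegen l n)) x"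
      by (simp add: abs_mult gweight_nonneg p_def mult.commute)
  qed
  also have "\<dots> = C * (gegen_sqnorm l 0 + gegen_sqnorm l n)"
    unfolding gegen_int_def[symmetric] gegen_int_smult gegen_int_add[OF l] gegen_sqnorm_def ..
  finally show ?thesis .
qed

text \<open>The witness is the image of \<open>F\<close> under \<open>m\<close> applications of the
  operator. Each application spends two derivatives and two powers of 1 - x. Since the witness is
  chosen before \<open>n\<close>, its bound is uniform in the degree.\<close>

lemma gegen_iterated_self_adjoint:
  assumes l: "l > -1/2"
  shows "flat_at_1 (2 * m) (2 * real m) F \<Longrightarrow> \<exists>E. flat_at_1 0 0 E \<and>
    (\<forall>n. (real n * (real n + 2 * l)) ^ m * (LBINT x:{-1<..<1}. gweight l x * (poly (gegen l n) x * F x))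
      = (LBINT x:{-1<..<1}. gweight l x * (poly (gegen l n) x * E x)))"
proof (induction m arbitrary: F)
  case 0
  then show ?case by (intro exI[of _ F]) simp
next
  case (Suc m)
  have e: "2 * Suc m = Suc (Suc (2 * m))" by simp
  obtain F1 where F1: "\<And>x. -1 < x \<Longrightarrow> x < 1 \<Longrightarrow> (F has_real_derivative F1 x) (at x)"
    "flat_at_1 (Suc (2 * m)) (2 * real (Suc m) - 1) F1"
    using flat_at_1_SucE[OF Suc.prems[unfolded e]] by blast
  obtain F2 where F2: "\<And>x. -1 < x \<Longrightarrow> x < 1 \<Longrightarrow> (F1 has_real_derivative F2 x) (at x)"
    "flat_at_1 (2 * m) (2 * real (Suc m) - 1 - 1) F2"
    using flat_at_1_SucE[OF F1(2)] by blast
  define LF where "LF = (\<lambda>x. (2 * l + 1) * x * F1 x - (1 - x\<^sup>2) * F2 x)"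
  have f1: "flat_at_1 (2 * m) (2 * real m) F1"
    by (rule flat_at_1_mono[OF _ flat_at_1_SucD[OF F1(2)]]) simp
  have f2: "flat_at_1 (2 * m) (2 * real m) F2"
    using F2(2) by (simp add: algebra_simps)
  have "flat_at_1 (2 * m) (0 + 2 * real m) (\<lambda>x. ((2 * l + 1) * x) * F1 x + (-1 + x * x) * F2 x)"
    by (intro flat_at_1_add flat_at_1_mult flat_at_1_cmult flat_at_1_ident f1 f2
       flat_at_1_add[OF flat_at_1_const flat_at_1_mult[OF flat_at_1_ident flat_at_1_ident, of _ , simplified]])
  moreover have "(\<lambda>x. ((2 * l + 1) * x) * F1 x + (-1 + x * x) * F2 x) = LF"
    by (simp add: LF_def fun_eq_iff power2_eq_square algebra_simps)
  ultimately have "flat_at_1 (2 * m) (2 * real m) LF" by simp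
  then obtain E where E: "flat_at_1 0 0 E"
    "\<And>n. (real n * (real n + 2 * l)) ^ m * (LBINT x:{-1<..<1}. gweight l x * (poly (gegen l n) x * LF x))
      = (LBINT x:{-1<..<1}. gweight l x * (poly (gegen l n) x * E x))"
    using Suc.IH by blast
  have bd: "\<exists>C. \<forall>x. -1 < x \<longrightarrow> x < 1 \<longrightarrow> \<bar>H x\<bar> \<le> C" if H: "flat_at_1 j s H" "s \<ge> 0" for j s H
    using flat_at_1_bound[OF flat_at_1_mono[OF H(2,1)]] by auto
  obtain C0 C1 C2 where C: "\<And>x. -1 < x \<Longrightarrow> x < 1 \<Longrightarrow> \<bar>F x\<bar> \<le> C0"
     "\<And>x. -1 < x \<Longrightarrow> x < 1 \<Longrightarrow> \<bar>F1 x\<bar> \<le> C1"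
     "\<And>x. -1 < x \<Longrightarrow> x < 1 \<Longrightarrow> \<bar>F2 x\<bar> \<le> C2"
    using bd[OF Suc.prems] bd[OF f1] bd[OF f2] by auto
  have "real n * (real n + 2 * l) * (LBINT x:{-1<..<1}. gweight l x * (poly (gegen l n) x * F x))
    = (LBINT x:{-1<..<1}. gweight l x * (poly (gegen l n) x * LF x))" for n
    unfolding LF_def
  proof (rule gegen_self_adjoint[OF l F1(1) F2(1) flat_at_1_continuous[OF f2], where C = "max C0 (max C1 C2)"])
    fix x :: real assume x: "-1 < x" "x < 1"
    show "\<bar>F x\<bar> \<le> max C0 (max C1 C2)" "\<bar>F1 x\<bar> \<le> max C0 (max C1 C2)" "\<bar>F2 x\<bar> \<le> max C0 (max C1 C2)"
      using C(1)[OF x] C(2)[OF x] C(3)[OF x] by auto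
  qed
  then have "(real n * (real n + 2 * l)) ^ Suc m * (LBINT x:{-1<..<1}. gweight l x * (poly (gegen l n) x * F x))
      = (LBINT x:{-1<..<1}. gweight l x * (poly (gegen l n) x * E x))" for n
    unfolding power_Suc2 mult.assoc[of _ "real n * (real n + 2 * l)"] E(2)[of n, symmetric] by (simp only:)
  with E(1) show ?case by blast
qed

text \<open>The eigenvalue is at least n^2 / 2 for n >= 2, so dividing by its m-th power gives n
  powr (- 2 m). The additional 2 in the exponent is the price of the quadratic bound on the
  norms.\<close>

lemma gegen_flat_bigo:
  assumes l: "l > -1/2" and F: "flat_at_1 (2 * m) (2 * real m) F"
  shows "(\<lambda>n. LBINT x:{-1<..<1}. gweight l x * (poly (gegen l n) x * F x)) \<in> O(\<lambda>n. real n powr (2 - 2 * real m))"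
proof -
  obtain E where E: "flat_at_1 0 0 E" and
    eq: "\<And>n. (real n * (real n + 2 * l)) ^ m * (LBINT x:{-1<..<1}. gweight l x * (poly (gegen l n) x * F x))
      = (LBINT x:{-1<..<1}. gweight l x * (poly (gegen l n) x * E x))"
    using gegen_iterated_self_adjoint[OF l F] by blast
  obtain C where C: "C \<ge> 0" "\<And>x. -1 < x \<Longrightarrow> x < 1 \<Longrightarrow> \<bar>E x\<bar> \<le> C"
    using flat_at_1_bound[OF E] by auto
  define D where "D = C * (gegen_sqnorm l 0 + gegen_sqnorm l 2)"
  have D: "D \<ge> 0" using C(1) by (simp add: D_def gegen_sqnorm_nonneg)
  have "norm (LBINT x:{-1<..<1}. gweight l x * (poly (gegen l n) x * F x)) \<le> (D * 2 ^ m) * norm (real n powr (2 - 2 * real m))"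
    if n: "n \<ge> 2" for n
  proof -
    define I where "I = (LBINT x:{-1<..<1}. gweight l x * (poly (gegen l n) x * F x))"
    have n1: "real n \<ge> 2" using n by simp
    have "(real n)\<^sup>2 / 2 \<le> real n * (real n + 2 * l)"
    proof -
      have "real n / 2 \<le> real n + 2 * l" using n1 l by linarith
      then have "real n * (real n / 2) \<le> real n * (real n + 2 * l)" by (intro mult_left_mono) auto
      then show ?thesis by (simp add: power2_eq_square)
    qed
    then have "((real n)\<^sup>2 / 2) ^ m * \<bar>I\<bar> \<le> (real n * (real n + 2 * l)) ^ m * \<bar>I\<bar>"
      by (intro mult_right_mono power_mono) auto
    also have "\<dots> = \<bar>(real n * (real n + 2 * l)) ^ m * I\<bar>"
      using n1 l by (simp add: abs_mult power_abs)
    also have "\<dots> = \<bar>LBINT x:{-1<..<1}. gweight l x * (poly (gegen l n) x * E x)\<bar>"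
      unfolding I_def eq ..
    also have "\<dots> \<le> C * (gegen_sqnorm l 0 + gegen_sqnorm l n)"
      by (rule gegen_abs_int_le[OF l flat_at_1_continuous[OF E] C(2)])
    also have "\<dots> \<le> C * (gegen_sqnorm l 0 * (real n)\<^sup>2 + gegen_sqnorm l 2 * (real n)\<^sup>2)"
    proof (intro mult_left_mono add_mono gegen_sqnorm_le[OF l n] C(1))
      have "1 \<le> (real n)\<^sup>2" using n1 by (simp add: one_le_power)
      then show "gegen_sqnorm l 0 \<le> gegen_sqnorm l 0 * (real n)\<^sup>2"
        using mult_left_mono[OF _ gegen_sqnorm_nonneg[of l 0], of 1 "(real n)\<^sup>2"] by simp
    qed
    also have "\<dots> = D * (real n)\<^sup>2" by (simp add: D_def algebra_simps)
    finally have "((real n)\<^sup>2 / 2) ^ m * \<bar>I\<bar> \<le> D * (real n)\<^sup>2" .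
    then have "\<bar>I\<bar> \<le> D * (real n)\<^sup>2 / ((real n)\<^sup>2 / 2) ^ m"
      using n1 by (subst pos_le_divide_eq) (auto simp: mult.commute)
    also have "\<dots> = (D * 2 ^ m) * ((real n)\<^sup>2 / (real n) ^ (2 * m))"
      by (simp add: power_divide power_mult)
    also have "(real n)\<^sup>2 / (real n) ^ (2 * m) = real n powr (2 - 2 * real m)"
    proof -
      have "real n powr real 2 = (real n)\<^sup>2" "real n powr real (2 * m) = real n ^ (2 * m)"
        by (rule powr_realpow, use n1 in simp)+
      then show ?thesis using powr_diff[of "real n" "real 2" "real (2 * m)"] by simp
    qed
    finally show ?thesis unfolding I_def by simp
  qed
  then show ?thesis by (intro bigoI[of _ "D * 2 ^ m"] eventually_sequentiallyI[of 2])
qed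

subsection \<open>Coefficient estimates\<close>

text \<open>The endpoints form a null set, so the conventional values of \<open>powr\<close> and
  \<open>ln\<close> at 0 do not affect the coefficients.\<close>

lemma set_integral_closed_unit:
  fixes f :: "real \<Rightarrow> real"
  shows "(LBINT x:{-1..1}. f x) = (LBINT x:{-1<..<1}. f x)"
  using interval_integral_Icc[of "-1" 1 f] interval_integral_Ioo[of "ereal (-1)" "ereal 1" f] by simp

definition gegen_pairing :: "real \<Rightarrow> (real \<Rightarrow> real) \<Rightarrow> nat \<Rightarrow> real" where
  "gegen_pairing l f n = (LBINT x:{-1<..<1}. gweight l x * (poly (gegen l n) x * f x))"

lemma gegen_pairing_reflect:
  "gegen_pairing l (\<lambda>x. f (- x)) n = (-1) ^ n * gegen_pairing l f n"
proof -
  have "gegen_pairing l (\<lambda>x. f (- x)) n = (LBINT x:{-1<..<1}. gweight l (- x) * (poly (gegen l n) (- x) * f (- (- x))))"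
    unfolding gegen_pairing_def
    using set_integral_reflect_unit[of "\<lambda>x. gweight l x * (poly (gegen l n) x * f (- x))"] by simp
  also have "\<dots> = (LBINT x:{-1<..<1}. (-1) ^ n * (gweight l x * (poly (gegen l n) x * f x)))"
    by (simp add: gweight_minus gegen_minus mult_ac)
  finally show ?thesis unfolding gegen_pairing_def by simp
qed

lemma gegen_pairing_log_bigo:
  assumes l: "l > -1/2" and c: "c + l > -1/2" and M: "M \<ge> 1"
    and g: "smooth_on_interval {-1..1} g"
  shows "gegen_pairing l (\<lambda>x. (1 - x) powr c * ln (1 - x) ^ M * g x)
    \<in> O(\<lambda>n. ln (real n) ^ (if c \<in> \<nat> then M - 1 else M) * real n powr (- 2 * c - 2 * l - 1))"
proof -
  define p where "p = - 2 * c - 2 * l - 1"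
  define e where "e = (if c \<in> \<nat> then M - 1 else M)"
  define T where "T = (\<lambda>n. ln (real n) ^ e * real n powr p)"
  have dominated: "(\<lambda>n. ln (real n) ^ j * real n powr q) \<in> O(T)" if "j \<le> e" "q \<le> p" for j q
  proof (rule bigoI[of _ 1])
    show "\<forall>\<^sub>F n in sequentially. norm (ln (real n) ^ j * real n powr q) \<le> 1 * norm (T n)"
    proof (rule eventually_sequentiallyI[of 3])
      fix n :: nat assume n: "n \<ge> 3"
      have ln1: "ln (real n) \<ge> 1" using n by (intro ln_ge_1) simp
      have "ln (real n) ^ j * real n powr q \<le> ln (real n) ^ e * real n powr p"
        using that ln1 n by (intro mult_mono power_increasing powr_mono) auto
      then show "norm (ln (real n) ^ j * real n powr q) \<le> 1 * norm (T n)"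
        unfolding T_def using ln1 by (simp add: abs_mult)
    qed
  qed
  \<comment> \<open>\<open>m\<close> makes the remainder bound n powr (2 - 2 m) at most n powr p.
    \<open>K\<close> then covers the 2 m derivatives and powers, one power for each of the
    \<open>M\<close> logarithms, and a possibly negative exponent \<open>c\<close>.\<close>
  obtain m :: nat where m: "(2 - p) / 2 \<le> real m" using real_arch_simple by blast
  obtain K :: nat where K: "2 * real m + real M + \<bar>c\<bar> \<le> real K" using real_arch_simple by blast
  obtain a where a: "flat_at_1 K (real K) (\<lambda>x. g x - (\<Sum>k<K. a k * (1 - x) ^ k))"
    using smooth_taylor_flat_at_1[OF g] by blast
  define F where "F = (\<lambda>x. (1 - x) powr c * ln (1 - x) ^ M * (g x - (\<Sum>k<K. a k * (1 - x) ^ k)))"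
  have "flat_at_1 K (c + - real M + real K) F"
    unfolding F_def by (intro flat_at_1_mult flat_at_1_powr flat_at_1_ln_power a)
  then have "flat_at_1 (2 * m) (c + - real M + real K) F"
    by (rule flat_at_1_le[rotated]) (use K in linarith)
  then have F: "flat_at_1 (2 * m) (2 * real m) F"
    by (rule flat_at_1_mono[rotated]) (use K in linarith)
  have "(\<lambda>n. gegen_pairing l F n) \<in> O(\<lambda>n. ln (real n) ^ 0 * real n powr (2 - 2 * real m))"
    using gegen_flat_bigo[OF l F] by (simp add: gegen_pairing_def)
  also have "(\<lambda>n. ln (real n) ^ 0 * real n powr (2 - 2 * real m)) \<in> O(T)"
    by (rule dominated) (use m in auto)
  finally have rem: "gegen_pairing l F \<in> O(T)" .
  have mom: "(\<lambda>n. gegen_moment l (c + real k) n M) \<in> O(T)" for k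
  proof -
    have "(\<lambda>n. gegen_moment l (c + real k) n M)
      \<in> O(\<lambda>n. ln (real n) ^ (if c + real k \<in> \<nat> then M - 1 else M) * real n powr (- 2 * (c + real k) - 2 * l - 1))"
      using c by (intro gegen_moment_bigo l M) auto
    \<comment> \<open>If \<open>c\<close> is natural, so is \<open>c + k\<close>; hence no later
      moment carries more logarithms than the first one.\<close>
    also have "(\<lambda>n. ln (real n) ^ (if c + real k \<in> \<nat> then M - 1 else M) * real n powr (- 2 * (c + real k) - 2 * l - 1)) \<in> O(T)"
      by (rule dominated) (auto simp: e_def p_def)
    finally show ?thesis .
  qed
  obtain C where C: "\<And>x. -1 < x \<Longrightarrow> x < 1 \<Longrightarrow> \<bar>F x\<bar> \<le> C"
    using flat_at_1_bound[OF flat_at_1_mono[OF _ F, of 0]] by auto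
  have split: "gegen_pairing l (\<lambda>x. (1 - x) powr c * ln (1 - x) ^ M * g x) n
     = (\<Sum>k<K. a k * gegen_moment l (c + real k) n M) + gegen_pairing l F n" for n
  proof -
    define H where "H = (\<lambda>k x. gweight l x * (poly (gegen l n) x * ((1 - x) powr (c + real k) * ln (1 - x) ^ M)))"
    have intH: "set_integrable lborel {-1<..<1} (H k)" for k
      unfolding H_def using c by (intro integrable_gweight_powr_ln l) auto
    have intF: "set_integrable lborel {-1<..<1} (\<lambda>x. gweight l x * (poly (gegen l n) x * F x))"
    proof -
      obtain B where B: "B \<ge> 0" "\<And>x. -1 < x \<Longrightarrow> x < 1 \<Longrightarrow> \<bar>poly (gegen l n) x\<bar> \<le> B"
        using poly_bounded_unit by blast
      show ?thesis
      proof (rule integrable_gweight_bounded[OF l])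
        show "\<bar>poly (gegen l n) x * F x\<bar> \<le> B * C" if "-1 < x" "x < 1" for x
          unfolding abs_mult using B C that by (intro mult_mono) auto
      qed (intro continuous_intros flat_at_1_continuous[OF F])
    qed
    have sum: "set_integrable lborel {-1<..<1} (\<lambda>x. \<Sum>k<j. a k * H k x)
       \<and> (LBINT x:{-1<..<1}. (\<Sum>k<j. a k * H k x)) = (\<Sum>k<j. a k * (LBINT x:{-1<..<1}. H k x))" for j
    proof (induction j)
      case (Suc j)
      then show ?case using intH[of j] by (simp add: set_integral_add)
    qed (simp add: set_integrable_def set_lebesgue_integral_def)
    have "gegen_pairing l (\<lambda>x. (1 - x) powr c * ln (1 - x) ^ M * g x) n
       = (LBINT x:{-1<..<1}. (\<Sum>k<K. a k * H k x) + gweight l x * (poly (gegen l n) x * F x))"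
      unfolding gegen_pairing_def
    proof (rule set_lebesgue_integral_cong, simp, intro allI impI)
      fix x :: real assume "x \<in> {-1<..<1}"
      then have x: "1 - x > 0" by simp
      have "H k x = gweight l x * (poly (gegen l n) x * ((1 - x) powr c * ln (1 - x) ^ M)) * (1 - x) ^ k" for k
        unfolding H_def using x by (simp add: powr_add powr_realpow mult_ac)
      then have "(\<Sum>k<K. a k * H k x) = gweight l x * (poly (gegen l n) x * ((1 - x) powr c * ln (1 - x) ^ M))
          * (\<Sum>k<K. a k * (1 - x) ^ k)"
        by (simp add: sum_distrib_left mult_ac)
      then show "gweight l x * (poly (gegen l n) x * ((1 - x) powr c * ln (1 - x) ^ M * g x))
         = (\<Sum>k<K. a k * H k x) + gweight l x * (poly (gegen l n) x * F x)"
        unfolding F_def by (simp add: algebra_simps)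
    qed
    also have "\<dots> = (\<Sum>k<K. a k * (LBINT x:{-1<..<1}. H k x)) + gegen_pairing l F n"
      unfolding gegen_pairing_def using sum[of K] intF by (simp add: set_integral_add)
    finally show ?thesis unfolding H_def gegen_moment_def .
  qed
  have "(\<lambda>n. (\<Sum>k<K. a k * gegen_moment l (c + real k) n M) + gegen_pairing l F n) \<in> O(T)"
  proof (intro sum_in_bigo(1) rem big_sum_in_bigo)
    fix k
    show "(\<lambda>n. a k * gegen_moment l (c + real k) n M) \<in> O(T)"
      using mom[of k] by (cases "a k = 0") simp_all
  qed
  then show ?thesis unfolding T_def e_def p_def split[abs_def] .
qed

text \<open>From n to n + 1 the Pochhammer quotient gains (n + 2 l) / (n + 1), and the norm
  recurrence cancels this down to (n + l) / (n + 1 + l), so the product telescopes. The first step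
  is separate because \<open>gegen_sqnorm_Suc_Suc\<close> starts at degree 1.\<close>

lemma pochhammer_sqnorm:
  assumes l: "l > -1/2" "l \<noteq> 0"
  shows "pochhammer (2 * l) n / fact n * gegen_sqnorm l n = gegen_sqnorm l 0 * l / (real n + l)"
proof (induction n)
  case (Suc n)
  show ?case
  proof (cases n)
    case 0
    have "gegen_sqnorm l 1 = gegen_sqnorm l 0 / (2 * (1 + l))"
      using gegen_sqnorm_1[OF l(1)] l by (simp add: field_simps)
    then show ?thesis using 0 l by (simp add: field_simps)
  next
    case (Suc k)
    define h where "h = gegen_sqnorm l (Suc (Suc k))"
    define q where "q = pochhammer (2 * l) n / fact n"
    have pos: "real k + 2 + l > 0" "real k + 1 + l > 0" using l by auto
    have rec: "(real k + 1 + 2 * l) * (real k + 2 + l) * h = (real k + 1 + l) * (real k + 2) * gegen_sqnorm l n"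
      unfolding h_def Suc by (rule gegen_sqnorm_Suc_Suc[OF l(1)])
    have IH: "q * gegen_sqnorm l n * (real k + 1 + l) = gegen_sqnorm l 0 * l"
      using Suc.IH pos unfolding q_def[symmetric] by (simp add: Suc field_simps)
    have "pochhammer (2 * l) (Suc n) / fact (Suc n) = q * (real k + 1 + 2 * l) / (real k + 2)"
      unfolding q_def pochhammer_Suc fact_Suc Suc by (simp add: add_ac)
    moreover have "q * (real k + 1 + 2 * l) / (real k + 2) * h = gegen_sqnorm l 0 * l / (real k + 2 + l)"
    proof -
      have "(q * (real k + 1 + 2 * l) * h) * (real k + 2 + l) = (gegen_sqnorm l 0 * l) * (real k + 2)"
        using rec IH by algebra
      then show ?thesis using pos by (simp add: field_simps)
    qed
    ultimately show ?thesis by (simp add: h_def Suc add_ac)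
  qed
qed (use l in simp)

text \<open>The normalising factor \<open>q\<close> occurs once in the numerator and twice in the
  norm. It is nonzero because \<open>2 * l > -1\<close> and \<open>2 * l\<close> is not 0, so one
  copy cancels and \<open>pochhammer_sqnorm\<close> evaluates what remains in closed form.\<close>

lemma gegenbauer_coeff_eq:
  assumes l: "l > -1/2" "l \<noteq> 0"
  shows "gegenbauer_coeff l f n = (real n + l) / (gegen_sqnorm l 0 * l) * gegen_pairing l f n"
proof -
  define q where "q = pochhammer (2 * l) n / fact n"
  have "q \<noteq> 0"
  proof -
    have "2 * l \<noteq> - real k" for k using l by (cases k) auto
    then show ?thesis by (simp add: q_def pochhammer_eq_0_iff)
  qed
  have eq: "poly (gegenbauer_poly l n) x = q * poly (gegen l n) x" for x
    unfolding gegenbauer_poly_eq[OF l(1)] q_def by simp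
  have norm: "gegenbauer_norm l n = q * (q * gegen_sqnorm l n)"
  proof -
    have "gegenbauer_norm l n = (LBINT x:{-1<..<1}. q * q * (gweight l x * poly (gegen l n * gegen l n) x))"
      unfolding gegenbauer_norm_def set_integral_closed_unit eq gweight_def
      by (simp add: power2_eq_square mult_ac)
    then show ?thesis unfolding gegen_sqnorm_def gegen_int_def by (simp add: mult.assoc)
  qed
  have "(LBINT x:{-1..1}. (1 - x\<^sup>2) powr (l - 1/2) * poly (gegenbauer_poly l n) x * f x)
      = (LBINT x:{-1<..<1}. q * (gweight l x * (poly (gegen l n) x * f x)))"
    unfolding set_integral_closed_unit eq gweight_def by (simp add: mult_ac)
  then have "gegenbauer_coeff l f n = q * gegen_pairing l f n / (q * (q * gegen_sqnorm l n))"
    unfolding gegenbauer_coeff_def norm gegen_pairing_def by simp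
  also have "\<dots> = gegen_pairing l f n / (q * gegen_sqnorm l n)" using \<open>q \<noteq> 0\<close> by simp
  also have "q * gegen_sqnorm l n = gegen_sqnorm l 0 * l / (real n + l)"
    unfolding q_def by (rule pochhammer_sqnorm[OF l])
  finally show ?thesis by simp
qed

lemma chebyshev_coeff_eq:
  "chebyshev_coeff f n = (if n = 0 then 1 else 2) / pi * gegen_pairing 0 f n"
proof -
  have "(LBINT x:{-1..1}. f x * poly (chebyshev_poly n) x / sqrt (1 - x\<^sup>2)) = gegen_pairing 0 f n"
    unfolding set_integral_closed_unit gegen_pairing_def
  proof (rule set_lebesgue_integral_cong, simp, intro allI impI)
    fix x :: real assume "x \<in> {-1<..<1}"
    then have "1 - x\<^sup>2 > 0" using one_minus_square_pos by simp
    then have "gweight 0 x = 1 / sqrt (1 - x\<^sup>2)"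
      using powr_minus[of "1 - x\<^sup>2" "1/2"] powr_half_sqrt[of "1 - x\<^sup>2"]
      by (simp add: gweight_def inverse_eq_divide)
    then show "f x * poly (chebyshev_poly n) x / sqrt (1 - x\<^sup>2) = gweight 0 x * (poly (gegen 0 n) x * f x)"
      by (simp add: gegen_0_eq_chebyshev mult_ac)
  qed
  then show ?thesis unfolding chebyshev_coeff_def by simp
qed

lemma gegenbauer_coeff_bigo:
  assumes l: "l > -1/2" "l \<noteq> 0"
    and J: "gegen_pairing l f \<in> O(\<lambda>n. ln (real n) ^ e * real n powr (- 2 * c - 2 * l - 1))"
  shows "(\<lambda>n. \<bar>gegenbauer_coeff l f n\<bar>) \<in> O(\<lambda>n. ln (real n) ^ e * real n powr (- 2 * l - 2 * c))"
proof -
  define A where "A = 1 / (gegen_sqnorm l 0 * l)"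
  have lin: "(\<lambda>n. A * (real n + l)) \<in> O(\<lambda>n. real n)"
  proof (rule bigoI[of _ "\<bar>A\<bar> * (1 + \<bar>l\<bar>)"], rule eventually_sequentiallyI[of 1])
    fix n :: nat assume n: "n \<ge> 1"
    have "\<bar>real n + l\<bar> \<le> real n + \<bar>l\<bar>" by linarith
    also have "\<dots> \<le> (1 + \<bar>l\<bar>) * real n" using n mult_left_mono[of 1 "real n" "\<bar>l\<bar>"] by (simp add: algebra_simps)
    finally have "\<bar>A\<bar> * \<bar>real n + l\<bar> \<le> \<bar>A\<bar> * ((1 + \<bar>l\<bar>) * real n)" by (intro mult_left_mono) auto
    then show "norm (A * (real n + l)) \<le> \<bar>A\<bar> * (1 + \<bar>l\<bar>) * norm (real n)"
      by (simp add: abs_mult mult.assoc)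
  qed
  have "(\<lambda>n. A * (real n + l) * gegen_pairing l f n)
     \<in> O(\<lambda>n. real n * (ln (real n) ^ e * real n powr (- 2 * c - 2 * l - 1)))"
    by (rule landau_o.big.mult[OF lin J])
  also have "(\<lambda>n. real n * (ln (real n) ^ e * real n powr (- 2 * c - 2 * l - 1)))
     \<in> \<Theta>(\<lambda>n. ln (real n) ^ e * real n powr (- 2 * l - 2 * c))"
  proof (rule bigthetaI_cong, rule eventually_sequentiallyI[of 1])
    fix n :: nat assume n: "n \<ge> 1"
    have "real n powr (- 2 * l - 2 * c) = real n powr (1 + (- 2 * c - 2 * l - 1))"
      by (rule arg_cong[where f = "\<lambda>u. real n powr u"]) simp
    also have "\<dots> = real n * real n powr (- 2 * c - 2 * l - 1)"
      unfolding powr_add using n by simp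
    finally show "real n * (ln (real n) ^ e * real n powr (- 2 * c - 2 * l - 1)) = ln (real n) ^ e * real n powr (- 2 * l - 2 * c)"
      by (simp only: mult.left_commute)
  qed
  finally have "(\<lambda>n. gegenbauer_coeff l f n) \<in> O(\<lambda>n. ln (real n) ^ e * real n powr (- 2 * l - 2 * c))"
    unfolding gegenbauer_coeff_eq[OF l] by (simp add: A_def)
  then show ?thesis by (simp only: landau_o.big.abs_in_iff)
qed

lemma chebyshev_coeff_bigo:
  assumes J: "gegen_pairing 0 f \<in> O(\<lambda>n. ln (real n) ^ e * real n powr (- 2 * c - 2 * 0 - 1))"
  shows "(\<lambda>n. \<bar>chebyshev_coeff f n\<bar>) \<in> O(\<lambda>n. ln (real n) ^ e * real n powr (- 1 - 2 * c))"
proof -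
  have "(\<lambda>n. \<bar>chebyshev_coeff f n\<bar>) \<in> O(gegen_pairing 0 f)"
  proof (rule bigoI[of _ "2 / pi"], intro always_eventually allI)
    fix n
    show "norm \<bar>chebyshev_coeff f n\<bar> \<le> 2 / pi * norm (gegen_pairing 0 f n)"
      unfolding chebyshev_coeff_eq by (simp add: abs_mult divide_right_mono mult_right_mono)
  qed
  from landau_o.big.trans[OF this J]
  have "(\<lambda>n. \<bar>chebyshev_coeff f n\<bar>) \<in> O(\<lambda>n. ln (real n) ^ e * real n powr (- 2 * c - 2 * 0 - 1))" .
  moreover have "- 1 - 2 * c = - 2 * c - 2 * 0 - 1" by simp
  ultimately show ?thesis by (simp only:)
qed

lemma coeff_bigo_right:
  fixes c :: real
  assumes M: "M \<ge> 1" and g: "smooth_on_interval {-1..1} g"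
  defines "f \<equiv> (\<lambda>x. (1 - x) powr c * ln (1 - x) ^ M * g x)"
    and "e \<equiv> (if c \<in> \<nat> then M - 1 else M)"
  shows "l > -1/2 \<Longrightarrow> l \<noteq> 0 \<Longrightarrow> l + c > -1/2 \<Longrightarrow>
      (\<lambda>n. \<bar>gegenbauer_coeff l f n\<bar>) \<in> O(\<lambda>n. ln (real n) ^ e * real n powr (- 2 * l - 2 * c))"
    and "c > -1/2 \<Longrightarrow>
      (\<lambda>n. \<bar>chebyshev_coeff f n\<bar>) \<in> O(\<lambda>n. ln (real n) ^ e * real n powr (- 1 - 2 * c))"
proof -
  show "(\<lambda>n. \<bar>gegenbauer_coeff l f n\<bar>) \<in> O(\<lambda>n. ln (real n) ^ e * real n powr (- 2 * l - 2 * c))"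
    if "l > -1/2" "l \<noteq> 0" "l + c > -1/2"
    unfolding f_def e_def using that
    by (intro gegenbauer_coeff_bigo gegen_pairing_log_bigo M g) (auto simp: add.commute)
  show "(\<lambda>n. \<bar>chebyshev_coeff f n\<bar>) \<in> O(\<lambda>n. ln (real n) ^ e * real n powr (- 1 - 2 * c))"
    if "c > -1/2"
    unfolding f_def e_def using that
    by (intro chebyshev_coeff_bigo gegen_pairing_log_bigo M g) auto
qed

section \<open>Reflection to the endpoint -1\<close>

lemma abs_gegenbauer_coeff_reflect:
  assumes "l > -1/2" "l \<noteq> 0"
  shows "\<bar>gegenbauer_coeff l (\<lambda>x. f (- x)) n\<bar> = \<bar>gegenbauer_coeff l f n\<bar>"
  unfolding gegenbauer_coeff_eq[OF assms] gegen_pairing_reflect by (simp add: abs_mult)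

lemma abs_chebyshev_coeff_reflect:
  "\<bar>chebyshev_coeff (\<lambda>x. f (- x)) n\<bar> = \<bar>chebyshev_coeff f n\<bar>"
  unfolding chebyshev_coeff_eq gegen_pairing_reflect by (simp add: abs_mult)

lemma smooth_on_interval_reflect:
  assumes "smooth_on_interval {-1..1} g"
  shows "smooth_on_interval {-1..1} (\<lambda>x. g (- x))"
proof -
  obtain G where G: "G 0 = g"
    "\<And>k x. x \<in> {-1..1} \<Longrightarrow> (G k has_real_derivative G (Suc k) x) (at x within {-1..1})"
    using assms unfolding smooth_on_interval_def by blast
  have im: "uminus ` {-1..1::real} = {-1..1}" by simp
  have "((\<lambda>x. (-1) ^ k * G k (- x)) has_real_derivative (-1) ^ Suc k * G (Suc k) (- x)) (at x within {-1..1})"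
    if x: "x \<in> {-1..1}" for k x
  proof -
    have "(G k has_real_derivative G (Suc k) (- x)) (at (- x) within uminus ` {-1..1})"
      unfolding im using G(2) x by simp
    then have "((G k \<circ> uminus) has_real_derivative G (Suc k) (- x) * (- 1)) (at x within {-1..1})"
      by (rule DERIV_image_chain) (auto intro!: derivative_eq_intros)
    from DERIV_cmult[OF this, of "(-1) ^ k"] show ?thesis by (simp add: o_def)
  qed
  then show ?thesis
    unfolding smooth_on_interval_def using G(1)
    by (intro exI[of _ "\<lambda>k x. (-1) ^ k * G k (- x)"]) auto
qed

lemma coeff_bigo_left:
  fixes c :: real
  assumes M: "M \<ge> 1" and g: "smooth_on_interval {-1..1} g"
  defines "f \<equiv> (\<lambda>x. (1 + x) powr c * ln (1 + x) ^ M * g x)"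
    and "e \<equiv> (if c \<in> \<nat> then M - 1 else M)"
  shows "l > -1/2 \<Longrightarrow> l \<noteq> 0 \<Longrightarrow> l + c > -1/2 \<Longrightarrow>
      (\<lambda>n. \<bar>gegenbauer_coeff l f n\<bar>) \<in> O(\<lambda>n. ln (real n) ^ e * real n powr (- 2 * l - 2 * c))"
    and "c > -1/2 \<Longrightarrow>
      (\<lambda>n. \<bar>chebyshev_coeff f n\<bar>) \<in> O(\<lambda>n. ln (real n) ^ e * real n powr (- 1 - 2 * c))"
proof -
  define h where "h = (\<lambda>x. (1 - x) powr c * ln (1 - x) ^ M * g (- x))"
  have h: "h = (\<lambda>x. f (- x))" by (simp add: h_def f_def)
  note * = coeff_bigo_right[OF M smooth_on_interval_reflect[OF g], where c = c, folded h_def e_def]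
  show "(\<lambda>n. \<bar>gegenbauer_coeff l f n\<bar>) \<in> O(\<lambda>n. ln (real n) ^ e * real n powr (- 2 * l - 2 * c))"
    if "l > -1/2" "l \<noteq> 0" "l + c > -1/2"
    using *(1)[OF that] unfolding h abs_gegenbauer_coeff_reflect[OF that(1,2)] .
  show "(\<lambda>n. \<bar>chebyshev_coeff f n\<bar>) \<in> O(\<lambda>n. ln (real n) ^ e * real n powr (- 1 - 2 * c))"
    if "c > -1/2"
    using *(2)[OF that] unfolding h abs_chebyshev_coeff_reflect .
qed

text \<open>The exceptional set is \<open>\<nat>\<close>: the saved logarithm comes from the index k
  equal to the exponent. A negative integer exponent meets no such index and falls under the case
  with the full power of the logarithm.\<close>

theorem corollary2:
  fixes \<mu> :: nat and g :: "real \<Rightarrow> real" and l \<gamma> \<delta> :: real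
  assumes "\<mu> \<ge> 1"
    and "smooth_on_interval {-1..1} g"
    and "l > -1/2" and "l \<noteq> 0"
  shows
  "(let f = (\<lambda>x. (1 - x) powr \<gamma> * ln (1 - x) ^ \<mu> * g x) in
    (l + \<gamma> > -1/2 \<and> \<gamma> \<notin> \<nat> \<longrightarrow>
       (\<lambda>n. \<bar>gegenbauer_coeff l f n\<bar>) \<in> O(\<lambda>n. ln (real n) ^ \<mu> * real n powr (- 2 * l - 2 * \<gamma>))) \<and>
    (l + \<gamma> > -1/2 \<and> \<gamma> \<in> \<nat> \<longrightarrow>
       (\<lambda>n. \<bar>gegenbauer_coeff l f n\<bar>) \<in> O(\<lambda>n. ln (real n) ^ (\<mu> - 1) * real n powr (- 2 * l - 2 * \<gamma>))) \<and>
    (\<gamma> > -1/2 \<and> \<gamma> \<notin> \<nat> \<longrightarrow>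
       (\<lambda>n. \<bar>chebyshev_coeff f n\<bar>) \<in> O(\<lambda>n. ln (real n) ^ \<mu> * real n powr (- 1 - 2 * \<gamma>))) \<and>
    (\<gamma> > -1/2 \<and> \<gamma> \<in> \<nat> \<longrightarrow>
       (\<lambda>n. \<bar>chebyshev_coeff f n\<bar>) \<in> O(\<lambda>n. ln (real n) ^ (\<mu> - 1) * real n powr (- 1 - 2 * \<gamma>)))) \<and>
   (let f = (\<lambda>x. (1 + x) powr \<delta> * ln (1 + x) ^ \<mu> * g x) in
    (l + \<delta> > -1/2 \<and> \<delta> \<notin> \<nat> \<longrightarrow>
       (\<lambda>n. \<bar>gegenbauer_coeff l f n\<bar>) \<in> O(\<lambda>n. ln (real n) ^ \<mu> * real n powr (- 2 * l - 2 * \<delta>))) \<and>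
    (l + \<delta> > -1/2 \<and> \<delta> \<in> \<nat> \<longrightarrow>
       (\<lambda>n. \<bar>gegenbauer_coeff l f n\<bar>) \<in> O(\<lambda>n. ln (real n) ^ (\<mu> - 1) * real n powr (- 2 * l - 2 * \<delta>))) \<and>
    (\<delta> > -1/2 \<and> \<delta> \<notin> \<nat> \<longrightarrow>
       (\<lambda>n. \<bar>chebyshev_coeff f n\<bar>) \<in> O(\<lambda>n. ln (real n) ^ \<mu> * real n powr (- 1 - 2 * \<delta>))) \<and>
    (\<delta> > -1/2 \<and> \<delta> \<in> \<nat> \<longrightarrow>
       (\<lambda>n. \<bar>chebyshev_coeff f n\<bar>) \<in> O(\<lambda>n. ln (real n) ^ (\<mu> - 1) * real n powr (- 1 - 2 * \<delta>))))"
proof -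
  note right = coeff_bigo_right[OF assms(1,2), where c = \<gamma>] and left = coeff_bigo_left[OF assms(1,2), where c = \<delta>]
  show ?thesis
    unfolding Let_def
    using right(1)[OF assms(3,4)] right(2) left(1)[OF assms(3,4)] left(2)
    by (cases "\<gamma> \<in> \<nat>"; cases "\<delta> \<in> \<nat>") simp_all
qed

end
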